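(* Let $m\in\{0,1\}$ and let $\mathcal S$ be a set of triples $(b,T,S_h(T))$. If Assumptions A1 and A2 (given in the context) hold, then there is a constant $C$ (independent of $v$, of $h$ and of the position of $\Omega$ relative to the mesh; it may depend on $\tau$) such that for all $v\in V_h$ $$\sum_{(b,T,S_h(T))\in\mathcal S} h^{\alpha_m}\|v\|_b^2\le C\left(\|\nabla^m v\|_\Omega^2+\|v\|_{s_{h,m}}^2\right).$$ Here, in the term of the triple $(b,T,S_h(T))$, $\|v\|_b$ means $\|(v|_T)^e\|_b$.
   Context: Mesh and spaces. $\mathcal T_{h,0}$ is a quasiuniform mesh of closed simplices with mesh parameter $h\in(0,h_0]$ on a closed polygonal domain $\Omega_0\subset\mathbb R^d$, and $V_{h,0}=\{v\in C^0(\Omega_0): v|_T\in\mathbb P_k(T)\ \forall T\in\mathcal T_{h,0}\}$, where $\mathbb P_k$ denotes polynomials of degree at most $k$. $\Omega\subset\Omega_0$ is a given closed domain, $\mathcal T_h=\{T\in\mathcal T_{h,0}:T\cap\Omega\ne\emptyset\}$ is the active mesh, $\Omega_h=\bigcup_{T\in\mathcal T_h}T$, and $V_h=V_{h,0}|_{\Omega_h}$. $\|\cdot\|_X$ is the $L^2(X)$ norm; $\nabla^0v=v$, $\nabla^1v=\nabla v$. Large and small elements. For a fixed $\gamma\in(0,1]$, $\mathcal T_h^L=\{T\in\mathcal T_h:|T\cap\Omega|\ge\gamma|T|\}$ and $\mathcal T_h^S=\mathcal T_h\setminus\mathcal T_h^L$. $S_h:\mathcal T_h^S\to\mathcal T_h^L$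 is a given map, assigning a large element to each small element. Stabilization. For a polynomial $p$ on an element, $p^e\in\mathbb P_k(\mathbb R^d)$ is its canonical extension. For $T_1,T_2\in\mathcal T_h$ and $v\in V_h$, $[v]_{T_1,T_2}=(v|_{T_1})^e-(v|_{T_2})^e\in\mathbb P_k(\mathbb R^d)$. $\mathcal S$ is a given set of triples of the form $(b,T,S_h(T))$ with $T\in\mathcal T_h^S$ and $b$ a symmetric positive semidefinite bilinear form on $\mathbb P_k(\mathbb R^d)$; $\|p\|_b=b(p,p)^{1/2}$. With a stabilization parameter $\tau>0$ and a parameter $\alpha_m$ (chosen so that the form stabilizes the $H^m$ norm), $$s_{h,m}(v,w)=\sum_{(b,T,S_h(T))\in\mathcal S}\tau h^{\alpha_m}b([v]_{T,S_h(T)},[w]_{T,S_h(T)}),\qquad \|v\|_{s_{h,m}}^2=s_{h,m}(v,v).$$ Assumptions, holding uniformly for all triples $(b,T,S_h(T))\in\mathcal S$: A1: there is a constant $C$ with $h^{\alpha_m}\|p\|_b^2\le C\|\nabla^m p\|_T^2$ for all $p\in\mathbb P_k(\mathbb R^d)$. A2: there is a path $\mathcal P_h(T,S_h(T))=\{T_j\in\mathcal T_h:j=1,\dots,n\}$ of face-neighboring elements starting in $T_1=T$ and ending in $T_n=S_h(T)$, with uniformly bounded length $n$.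
   Formalization: The set of triples is additionally assumed to contain at most M triples for each small element T, and C may depend on M; without such a bound, many nearly equal forms on one element make the left side arbitrarily large for v = 1, m = 0. *)

theory Defs
  imports "HOL-Analysis.Analysis"
begin

section \<open>Polynomials of bounded degree\<close>

definition monomial_fun :: "('d \<Rightarrow> nat) \<Rightarrow> real ^ 'd \<Rightarrow> real" where
  "monomial_fun \<mu> x = (\<Prod>i\<in>UNIV. (x $ i) ^ \<mu> i)"

definition poly_space :: "nat \<Rightarrow> (real ^ 'd \<Rightarrow> real) set" where
  "poly_space k =
     {p. \<exists>c. p = (\<lambda>x. \<Sum>\<mu> | sum \<mu> UNIV \<le> k. c \<mu> * monomial_fun \<mu> x)}"

text \<open>The polynomial agreeing with \<open>v\<close> on \<open>T\<close>. It is unique because \<open>T\<close> has nonempty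
  interior whenever it is an element of a mesh.\<close>
definition canonical_ext :: "nat \<Rightarrow> (real ^ 'd \<Rightarrow> real) \<Rightarrow> (real ^ 'd) set \<Rightarrow> real ^ 'd \<Rightarrow> real" where
  "canonical_ext k v T = (THE p. p \<in> poly_space k \<and> (\<forall>x\<in>T. p x = v x))"

definition jump ::
    "nat \<Rightarrow> (real ^ 'd \<Rightarrow> real) \<Rightarrow> (real ^ 'd) set \<Rightarrow> (real ^ 'd) set \<Rightarrow> real ^ 'd \<Rightarrow> real" where
  "jump k v T1 T2 = (\<lambda>x. canonical_ext k v T1 x - canonical_ext k v T2 x)"

section \<open>Domains and meshes\<close>

definition closed_domain :: "'a::topological_space set \<Rightarrow> bool" where
  "closed_domain \<Omega> \<longleftrightarrow> (\<exists>U. open U \<and> connected U \<and> U \<noteq> {} \<and> \<Omega> = closure U)"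

definition polygonal_domain :: "'a::euclidean_space set \<Rightarrow> bool" where
  "polygonal_domain \<Omega> \<longleftrightarrow> closed_domain \<Omega> \<and>
     (\<exists>\<P>. finite \<P> \<and> (\<forall>P\<in>\<P>. polytope P) \<and> \<Omega> = \<Union>\<P>)"

definition simplicial_mesh :: "(real ^ 'd) set \<Rightarrow> (real ^ 'd) set set \<Rightarrow> bool" where
  "simplicial_mesh \<Omega>0 \<T> \<longleftrightarrow>
     triangulation \<T> \<and> (\<forall>T\<in>\<T>. int CARD('d) simplex T) \<and> \<Union>\<T> = \<Omega>0"

text \<open>Quasiuniformity in the form of Brenner and Scott: all elements have diameter at most \<open>h\<close>
  and contain a ball of radius \<open>\<rho> * h\<close>. The constant \<open>\<rho>\<close> is common to the whole family
  of meshes.\<close>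
definition quasiuniform_mesh :: "real \<Rightarrow> real \<Rightarrow> (real ^ 'd) set \<Rightarrow> (real ^ 'd) set set \<Rightarrow> bool" where
  "quasiuniform_mesh \<rho> h \<Omega>0 \<T> \<longleftrightarrow> simplicial_mesh \<Omega>0 \<T> \<and>
     (\<forall>T\<in>\<T>. diameter T \<le> h \<and> (\<exists>x. cball x (\<rho> * h) \<subseteq> T))"

definition active_mesh :: "'a set \<Rightarrow> 'a set set \<Rightarrow> 'a set set" where
  "active_mesh \<Omega> \<T> = {T\<in>\<T>. T \<inter> \<Omega> \<noteq> {}}"

definition large_elements :: "real \<Rightarrow> (real ^ 'd) set \<Rightarrow> (real ^ 'd) set set \<Rightarrow> (real ^ 'd) set set" where
  "large_elements \<gamma> \<Omega> \<T> =
     {T \<in> active_mesh \<Omega> \<T>. measure lebesgue (T \<inter> \<Omega>) \<ge> \<gamma> * measure lebesgue T}"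

definition small_elements :: "real \<Rightarrow> (real ^ 'd) set \<Rightarrow> (real ^ 'd) set set \<Rightarrow> (real ^ 'd) set set" where
  "small_elements \<gamma> \<Omega> \<T> = active_mesh \<Omega> \<T> - large_elements \<gamma> \<Omega> \<T>"

definition face_neighbors :: "'a::euclidean_space set \<Rightarrow> 'a set \<Rightarrow> bool" where
  "face_neighbors T1 T2 \<longleftrightarrow> (T1 \<inter> T2) facet_of T1 \<and> (T1 \<inter> T2) facet_of T2"

section \<open>Finite element spaces and norms\<close>

definition fe_space :: "nat \<Rightarrow> (real ^ 'd) set \<Rightarrow> (real ^ 'd) set set \<Rightarrow> (real ^ 'd \<Rightarrow> real) set" where
  "fe_space k \<Omega>0 \<T> =
     {v. continuous_on \<Omega>0 v \<and> (\<forall>T\<in>\<T>. \<exists>p\<in>poly_space k. \<forall>x\<in>T. v x = p x)}"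

definition active_fe_space ::
    "nat \<Rightarrow> (real ^ 'd) set \<Rightarrow> (real ^ 'd) set \<Rightarrow> (real ^ 'd) set set \<Rightarrow> (real ^ 'd \<Rightarrow> real) set" where
  "active_fe_space k \<Omega>0 \<Omega> \<T> = (\<lambda>v. restrict v (\<Union>(active_mesh \<Omega> \<T>))) ` fe_space k \<Omega>0 \<T>"

definition l2_norm :: "(real ^ 'd) set \<Rightarrow> (real ^ 'd \<Rightarrow> 'b::real_normed_vector) \<Rightarrow> real" where
  "l2_norm X f = sqrt (LINT x:X|lebesgue. (norm (f x))\<^sup>2)"

text \<open>The pointwise gradient. A finite element function is differentiable away from the element
  boundaries, a null set, so there the arbitrary value of \<open>frechet_derivative\<close> has no effect
  on \<open>L\<^sup>2\<close> norms; almost everywhere the value is that of the weak gradient.\<close>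
definition grad :: "(real ^ 'd \<Rightarrow> real) \<Rightarrow> real ^ 'd \<Rightarrow> real ^ 'd" where
  "grad v x = (\<chi> i. frechet_derivative v (at x) (axis i 1))"

text \<open>The \<open>L\<^sup>2(X)\<close> norm of the \<open>m\<close>-th gradient, meant for \<open>m = 0\<close> and \<open>m = 1\<close> only.\<close>
definition l2_grad_norm :: "nat \<Rightarrow> (real ^ 'd) set \<Rightarrow> (real ^ 'd \<Rightarrow> real) \<Rightarrow> real" where
  "l2_grad_norm m X v = (if m = 0 then l2_norm X v else l2_norm X (grad v))"

section \<open>Stabilization\<close>

type_synonym 'p form = "('p \<Rightarrow> real) \<Rightarrow> ('p \<Rightarrow> real) \<Rightarrow> real"

text \<open>A form on \<open>poly_space k\<close> is represented by a function that vanishes as soon as one argument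
  is not in \<open>poly_space k\<close>, so that equality of representatives is equality of forms.\<close>
definition sym_psd_form :: "nat \<Rightarrow> (real ^ 'd) form \<Rightarrow> bool" where
  "sym_psd_form k b \<longleftrightarrow>
     (\<forall>p\<in>poly_space k. \<forall>q\<in>poly_space k. b p q = b q p) \<and>
     (\<forall>p\<in>poly_space k. \<forall>q\<in>poly_space k. \<forall>r\<in>poly_space k. \<forall>s t.
        b (\<lambda>x. s * p x + t * q x) r = s * b p r + t * b q r) \<and>
     (\<forall>p\<in>poly_space k. 0 \<le> b p p) \<and>
     (\<forall>p q. p \<notin> poly_space k \<or> q \<notin> poly_space k \<longrightarrow> b p q = 0)"

definition form_norm :: "(real ^ 'd) form \<Rightarrow> (real ^ 'd \<Rightarrow> real) \<Rightarrow> real" where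
  "form_norm b p = sqrt (b p p)"

type_synonym 'p stab_triple = "'p form \<times> 'p set \<times> 'p set"

definition stab_triples ::
    "nat \<Rightarrow> real \<Rightarrow> (real ^ 'd) set \<Rightarrow> (real ^ 'd) set set \<Rightarrow> ((real ^ 'd) set \<Rightarrow> (real ^ 'd) set)
      \<Rightarrow> (real ^ 'd) stab_triple set \<Rightarrow> bool" where
  "stab_triples k \<gamma> \<Omega> \<T> Sh \<S> \<longleftrightarrow>
     (\<forall>(b, T, T') \<in> \<S>. sym_psd_form k b \<and> T \<in> small_elements \<gamma> \<Omega> \<T> \<and> T' = Sh T)"

text \<open>At most \<open>M\<close> forms are attached to each element. Some such bound is implicit in a constant
  that is uniform in the mesh: repeating essentially the same form on one element arbitrarily often
  multiplies the sum of the \<open>h powr \<alpha> * (form_norm b v)\<^sup>2\<close>, while for a globally polynomial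
  \<open>v\<close> all jumps vanish.\<close>
definition multiplicity_le :: "nat \<Rightarrow> (real ^ 'd) stab_triple set \<Rightarrow> bool" where
  "multiplicity_le M \<S> \<longleftrightarrow>
     (\<forall>T. finite {(b, T1, T2) \<in> \<S>. T1 = T} \<and> card {(b, T1, T2) \<in> \<S>. T1 = T} \<le> M)"

definition stab_form ::
    "nat \<Rightarrow> real \<Rightarrow> real \<Rightarrow> real \<Rightarrow> (real ^ 'd) stab_triple set
      \<Rightarrow> (real ^ 'd \<Rightarrow> real) \<Rightarrow> (real ^ 'd \<Rightarrow> real) \<Rightarrow> real" where
  "stab_form k \<tau> \<alpha> h \<S> v w =
     (\<Sum>(b, T, T') \<in> \<S>. \<tau> * h powr \<alpha> * b (jump k v T T') (jump k w T T'))"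

definition stab_norm ::
    "nat \<Rightarrow> real \<Rightarrow> real \<Rightarrow> real \<Rightarrow> (real ^ 'd) stab_triple set \<Rightarrow> (real ^ 'd \<Rightarrow> real) \<Rightarrow> real" where
  "stab_norm k \<tau> \<alpha> h \<S> v = sqrt (stab_form k \<tau> \<alpha> h \<S> v v)"

definition assumption_A1 ::
    "nat \<Rightarrow> nat \<Rightarrow> real \<Rightarrow> real \<Rightarrow> real \<Rightarrow> (real ^ 'd) stab_triple set \<Rightarrow> bool" where
  "assumption_A1 k m \<alpha> C h \<S> \<longleftrightarrow>
     (\<forall>(b, T, T') \<in> \<S>. \<forall>p\<in>poly_space k.
        h powr \<alpha> * (form_norm b p)\<^sup>2 \<le> C * (l2_grad_norm m T p)\<^sup>2)"

definition assumption_A2 ::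
    "nat \<Rightarrow> (real ^ 'd) set \<Rightarrow> (real ^ 'd) set set \<Rightarrow> (real ^ 'd) stab_triple set \<Rightarrow> bool" where
  "assumption_A2 N \<Omega> \<T> \<S> \<longleftrightarrow>
     (\<forall>(b, T, T') \<in> \<S>. \<exists>Ts. Ts \<noteq> [] \<and> length Ts \<le> N \<and> set Ts \<subseteq> active_mesh \<Omega> \<T> \<and>
        hd Ts = T \<and> last Ts = T' \<and> successively face_neighbors Ts)"

end

theory Submission
  imports Defs
begin

text \<open>
  Replacing \<open>v\<bar>T\<close> by the extension of \<open>v\<bar>T'\<close>, with \<open>T' = S\<^sub>h(T)\<close>, costs a jump term,
  which \<open>s\<^sub>h\<^sub>,\<^sub>m\<close> controls. By A1 and A2 what remains is to bound the integral over \<open>T\<close> of the square of a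
  polynomial by its integral over \<open>T' \<inter> \<Omega>\<close>, a set which lies in a ball of radius
  comparable to \<open>h\<close> containing also \<open>T\<close> and which fills a fixed fraction of that ball. The constant does not
  depend on how \<open>\<Omega>\<close> cuts \<open>T'\<close>: on the unit scale, the set where a polynomial \<open>p\<close> of degree at most \<open>k\<close>
  is smaller than \<open>\<epsilon> * sup \<bar>p\<bar>\<close> has measure at most \<open>\<delta>\<close> once \<open>\<epsilon>\<close> is small, uniformly in \<open>p\<close>, by
  compactness of the sphere of coefficients and because zero sets of polynomials are null sets.
  Comparing volumes, each \<open>T'\<close> serves a bounded number of small elements.
\<close>

section \<open>Sublevel sets\<close>

text \<open>Every line through \<open>a\<close> contains only finitely many zeros. By Fubini, for almost every \<open>t\<close> the zero set
  scaled by \<open>1 / t\<close> about \<open>a\<close> is a null set, and one such \<open>t \<noteq> 0\<close> suffices.\<close>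
lemma negligible_zeros_real_polynomial_function:
  fixes q :: "'a::euclidean_space \<Rightarrow> real"
  assumes q: "real_polynomial_function q" and a: "q a \<noteq> 0"
  shows "negligible {x. q x = 0}"
proof -
  have fin: "finite {t. q (a + t *\<^sub>R x) = 0}" for x
  proof -
    have "polynomial_function (\<lambda>t. a + t *\<^sub>R x)"
      by (intro polynomial_function_add polynomial_function_const
          polynomial_function_bounded_linear bounded_linear_scaleR_left)
    then have "real_polynomial_function (\<lambda>t. q (a + t *\<^sub>R x))"
      using real_polynomial_function_compose[OF _ q] by (auto simp: o_def)
    then obtain c n where c: "(\<lambda>t. q (a + t *\<^sub>R x)) = (\<lambda>t. \<Sum>i\<le>n. c i * t ^ i)"
      by (auto simp: real_polynomial_function_iff_sum)
    have "\<exists>i\<le>n. c i \<noteq> 0"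
    proof (rule ccontr)
      assume "\<not> ?thesis"
      then have "q (a + 0 *\<^sub>R x) = 0" using fun_cong[OF c, of 0] by simp
      then show False using a by simp
    qed
    then have "finite {t. (\<Sum>i\<le>n. c i * t ^ i) = 0}"
      by (subst polyfun_finite_roots) auto
    then show ?thesis using fun_cong[OF c] by simp
  qed
  have cont: "continuous_on UNIV q"
    using q by (simp add: continuous_on_polymonial_function real_polynomial_function_eq)
  \<comment> \<open>Exchanging the two quantifiers by Fubini requires joint measurability in the
    point and the scale; it comes from the zero set being closed in the product.\<close>
  have "closed {z :: 'a \<times> real. q (a + snd z *\<^sub>R fst z) = 0}"
    by (intro closed_Collect_eq continuous_intros continuous_on_compose2[OF cont]) auto
  then have meas: "Measurable.pred (lborel \<Otimes>\<^sub>M lborel) (\<lambda>z :: 'a \<times> real. q (a + snd z *\<^sub>R fst z) \<noteq> 0)"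
    by (intro pred_intros_logic) (simp add: pred_def lborel_prod borel_closed)
  have "AE t in lborel. q (a + t *\<^sub>R x) \<noteq> 0" for x
    using AE_not_in[OF finite_imp_null_set_lborel[OF fin[of x]]] by simp
  then have "AE x in lborel. AE t in lborel. q (a + t *\<^sub>R x) \<noteq> 0"
    by simp
  then have "AE t in lborel. AE x in lborel. q (a + t *\<^sub>R x) \<noteq> 0"
    using lborel_pair.AE_commute[of "\<lambda>x t. q (a + t *\<^sub>R x) \<noteq> 0"] meas
    by (simp add: pred_def split_beta)
  then have "AE t in lborel. t \<noteq> 0 \<and> (AE x in lborel. q (a + t *\<^sub>R x) \<noteq> 0)"
    using AE_lborel_singleton[of 0] by eventually_elim auto
  moreover have "ae_filter (lborel :: real measure) \<noteq> bot"
    by (simp add: ae_filter_eq_bot_iff)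
  ultimately have "\<exists>t. t \<noteq> 0 \<and> (AE x in lborel. q (a + t *\<^sub>R x) \<noteq> 0)"
    by (rule eventually_happens'[rotated])
  then obtain t where "t \<noteq> 0" and t: "AE x in lborel. q (a + t *\<^sub>R x) \<noteq> 0" by blast
  have "negligible {x. q (a + t *\<^sub>R x) = 0}"
    using AE_completion[OF t] AE_iff_null_sets[of _ lebesgue]
    by (auto simp: eventually_ae_filter negligible_iff_null_sets intro: completion.complete2)
  then have "emeasure lebesgue ((\<lambda>x. t *\<^sub>R x + a) ` {x. q (a + t *\<^sub>R x) = 0}) = 0"
    by (subst emeasure_lebesgue_affine) (simp add: negligible_iff_null_sets null_setsD1)
  moreover have "(\<lambda>x. t *\<^sub>R x + a) ` {x. q (a + t *\<^sub>R x) = 0} = {x. q x = 0}"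
  proof (intro equalityI subsetI)
    fix x assume "x \<in> {x. q x = 0}"
    then have "x = t *\<^sub>R ((x - a) /\<^sub>R t) + a" and "(x - a) /\<^sub>R t \<in> {x. q (a + t *\<^sub>R x) = 0}"
      using \<open>t \<noteq> 0\<close> by auto
    then show "x \<in> (\<lambda>x. t *\<^sub>R x + a) ` {x. q (a + t *\<^sub>R x) = 0}" by blast
  qed (auto simp: add.commute)
  moreover have "{x. q x = 0} \<in> sets lebesgue"
    using cont by (intro sets_completionI_sets) (simp add: closed_Collect_eq)
  ultimately show ?thesis by (simp add: negligible_iff_emeasure0)
qed

text \<open>Bolzano-Weierstrass, one coordinate at a time: a further subsequence for the new index
  keeps the limits already found. It is applied to normalized coefficient vectors.\<close>

lemma finite_family_convergent_subseq:
  fixes c :: "nat \<Rightarrow> 'i \<Rightarrow> real"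
  assumes "finite I" and "\<And>n i. i \<in> I \<Longrightarrow> \<bar>c n i\<bar> \<le> K"
  shows "\<exists>r l. strict_mono (r :: nat \<Rightarrow> nat) \<and> (\<forall>i\<in>I. (\<lambda>n. c (r n) i) \<longlonglongrightarrow> l i)"
  using assms
proof (induction I)
  case empty
  show ?case by (intro exI[of _ id]) (simp add: strict_mono_def)
next
  case (insert j I)
  then obtain r l where r: "strict_mono (r :: nat \<Rightarrow> nat)"
    and l: "\<And>i. i \<in> I \<Longrightarrow> (\<lambda>n. c (r n) i) \<longlonglongrightarrow> l i" by fastforce
  have "compact {-K..K}" and "\<forall>n. c (r n) j \<in> {-K..K}"
    using insert.prems by (auto simp: abs_le_iff minus_le_iff)
  then obtain l' s where s: "strict_mono (s :: nat \<Rightarrow> nat)" "((\<lambda>n. c (r n) j) \<circ> s) \<longlonglongrightarrow> l'"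
    unfolding compact_def by metis
  have "(\<lambda>n. c ((r \<circ> s) n) i) \<longlonglongrightarrow> (if i = j then l' else l i)" if "i \<in> insert j I" for i
    using that s l LIMSEQ_subseq_LIMSEQ[OF l s(1)] by (auto simp: o_def)
  with strict_mono_o[OF r s(1)] show ?case
    by (intro exI[of _ "r \<circ> s"] exI[of _ "\<lambda>i. if i = j then l' else l i"] conjI ballI)
qed

lemma finite_family_independent_subfamily:
  fixes f :: "'i \<Rightarrow> 'a \<Rightarrow> real"
  assumes "finite I"
  shows "\<exists>J\<subseteq>I. (\<forall>c. \<exists>d. \<forall>x. (\<Sum>i\<in>I. c i * f i x) = (\<Sum>j\<in>J. d j * f j x)) \<and>
    (\<forall>d. (\<forall>x. (\<Sum>j\<in>J. d j * f j x) = 0) \<longrightarrow> (\<forall>j\<in>J. d j = 0))"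
  using assms
proof (induction I rule: finite_psubset_induct)
  case (psubset I)
  show ?case
  proof (cases "\<forall>d. (\<forall>x. (\<Sum>j\<in>I. d j * f j x) = 0) \<longrightarrow> (\<forall>j\<in>I. d j = 0)")
    case True
    then show ?thesis by (intro exI[of _ I]) auto
  next
    case False
    then obtain d j where d: "\<And>x. (\<Sum>i\<in>I. d i * f i x) = 0" and j: "j \<in> I" "d j \<noteq> 0" by blast
    then have "I - {j} \<subset> I" by blast
    from psubset.IH[OF this] obtain J where J: "J \<subseteq> I - {j}"
      "\<And>c. \<exists>d. \<forall>x. (\<Sum>i\<in>I - {j}. c i * f i x) = (\<Sum>j\<in>J. d j * f j x)"
      "\<forall>d. (\<forall>x. (\<Sum>j\<in>J. d j * f j x) = 0) \<longrightarrow> (\<forall>j\<in>J. d j = 0)" by blast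
    \<comment> \<open>The multiple \<open>c j / d j\<close> of the vanishing combination is chosen
      so that subtracting it cancels the coefficient of \<open>f j\<close>.\<close>
    have "(\<Sum>i\<in>I. c i * f i x) = (\<Sum>i\<in>I - {j}. (c i - c j / d j * d i) * f i x)" for c x
    proof -
      have "(\<Sum>i\<in>I. c i * f i x) = (\<Sum>i\<in>I. c i * f i x) - c j / d j * (\<Sum>i\<in>I. d i * f i x)"
        using d by simp
      also have "\<dots> = (\<Sum>i\<in>I. (c i - c j / d j * d i) * f i x)"
        by (simp add: sum_subtractf sum_distrib_left algebra_simps)
      also have "\<dots> = (\<Sum>i\<in>I - {j}. (c i - c j / d j * d i) * f i x)"
        using j by (subst sum.remove[OF psubset.hyps j(1)]) simp
      finally show ?thesis .
    qed
    then have "\<exists>d. \<forall>x. (\<Sum>i\<in>I. c i * f i x) = (\<Sum>j\<in>J. d j * f j x)" for c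
      using J(2)[of "\<lambda>i. c i - c j / d j * d i"] by simp
    with J show ?thesis by (intro exI[of _ J]) blast
  qed
qed

section \<open>Measures of sublevel sets, for one function and for a finite-dimensional
  family\<close>

lemma lmeasurable_sublevel:
  fixes q :: "'a::euclidean_space \<Rightarrow> real"
  assumes B: "compact B" and q: "continuous_on B q"
  shows "{x\<in>B. \<bar>q x\<bar> \<le> e} \<in> lmeasurable" and "{x\<in>B. \<bar>q x\<bar> < e} \<in> lmeasurable"
proof -
  have *: "S \<in> lmeasurable" if "closed S" "S \<subseteq> B" for S
    using compact_Int_closed[OF B \<open>closed S\<close>] that by (simp add: inf.absorb2 lmeasurable_compact)
  show "{x\<in>B. \<bar>q x\<bar> \<le> e} \<in> lmeasurable"
    using B q
    by (intro * continuous_on_closed_Collect_le continuous_on_rabs continuous_on_const) (auto intro: compact_imp_closed)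
  have "{x\<in>B. e \<le> \<bar>q x\<bar>} \<in> lmeasurable"
    using B q
    by (intro * continuous_on_closed_Collect_le continuous_on_rabs continuous_on_const) (auto intro: compact_imp_closed)
  then have "B - {x\<in>B. e \<le> \<bar>q x\<bar>} \<in> lmeasurable"
    using lmeasurable_compact[OF B] by (intro fmeasurable.Diff)
  moreover have "B - {x\<in>B. e \<le> \<bar>q x\<bar>} = {x\<in>B. \<bar>q x\<bar> < e}" by auto
  ultimately show "{x\<in>B. \<bar>q x\<bar> < e} \<in> lmeasurable" by simp
qed

text \<open>The sets where \<bar>q\<bar> is at most 1 / (n + 1) have finite measure and decrease to
  the zero set, so continuity of the measure from above applies.\<close>

lemma measure_sublevel_small:
  fixes q :: "'a::euclidean_space \<Rightarrow> real"
  assumes B: "compact B" and q: "continuous_on B q" and neg: "negligible {x\<in>B. q x = 0}"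
    and "\<delta> > 0"
  shows "\<exists>\<epsilon>>0. measure lebesgue {x\<in>B. \<bar>q x\<bar> \<le> \<epsilon>} \<le> \<delta>"
proof -
  define A where "A = (\<lambda>n::nat. {x\<in>B. \<bar>q x\<bar> \<le> 1 / Suc n})"
  have A: "A n \<in> lmeasurable" for n
    unfolding A_def by (intro lmeasurable_sublevel B q)
  have "(\<lambda>n. measure lebesgue (A n)) \<longlonglongrightarrow> measure lebesgue (\<Inter>n. A n)"
  proof (rule Lim_measure_decseq)
    show "decseq A"
      unfolding A_def decseq_def by (force intro: order_trans simp: frac_le)
    show "emeasure lebesgue (A n) \<noteq> \<infinity>" for n
      using fmeasurableD2[OF A[of n]] by simp
  qed (use A in blast)
  moreover have "(\<Inter>n. A n) = {x\<in>B. q x = 0}"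
  proof -
    have "q x = 0" if "\<And>n::nat. \<bar>q x\<bar> \<le> 1 / Suc n" for x
      using that reals_Archimedean[of "\<bar>q x\<bar>"] by (force simp: inverse_eq_divide not_less[symmetric])
    then show ?thesis by (auto simp: A_def)
  qed
  ultimately have "(\<lambda>n. measure lebesgue (A n)) \<longlonglongrightarrow> 0"
    using neg by (simp add: negligible_imp_measure0)
  then have "\<forall>\<^sub>F n in sequentially. measure lebesgue (A n) < \<delta>"
    using \<open>\<delta> > 0\<close> by (rule order_tendstoD)
  then obtain n where "measure lebesgue (A n) < \<delta>"
    by (auto simp: eventually_sequentially)
  then show ?thesis unfolding A_def by (intro exI[of _ "1 / Suc n"]) auto
qed

text \<open>On a linearly independent subfamily, a limit of normalized coefficients cannot give the zero
  function.\<close>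
lemma uniform_sublevel_estimate:
  fixes f :: "'i \<Rightarrow> 'a::euclidean_space \<Rightarrow> real"
  assumes I: "finite I" and B: "compact B" and f: "\<And>i. i \<in> I \<Longrightarrow> continuous_on B (f i)"
    and neg: "\<And>c y. (\<Sum>i\<in>I. c i * f i y) \<noteq> 0 \<Longrightarrow> negligible {x\<in>B. (\<Sum>i\<in>I. c i * f i x) = 0}"
    and \<delta>: "\<delta> > 0"
  shows "\<exists>\<epsilon>>0. \<forall>c. \<forall>z\<in>B.
    measure lebesgue {x\<in>B. \<bar>\<Sum>i\<in>I. c i * f i x\<bar> < \<epsilon> * \<bar>\<Sum>i\<in>I. c i * f i z\<bar>} \<le> \<delta>"
proof -
  obtain J where "J \<subseteq> I"
    and JI: "\<And>c. \<exists>d. \<forall>x. (\<Sum>i\<in>I. c i * f i x) = (\<Sum>j\<in>J. d j * f j x)"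
    and ind: "\<And>d. (\<forall>x. (\<Sum>j\<in>J. d j * f j x) = 0) \<Longrightarrow> (\<forall>j\<in>J. d j = 0)"
    using finite_family_independent_subfamily[OF I, of f] by metis
  then have J: "finite J" using I finite_subset by blast
  define Q where "Q = (\<lambda>d x. \<Sum>j\<in>J. d j * f j x)"
  have Q_cont: "continuous_on B (Q d)" for d
    unfolding Q_def using f \<open>J \<subseteq> I\<close> by (auto intro!: continuous_intros)
  have Q_neg: "negligible {x\<in>B. Q d x = 0}" if "Q d y \<noteq> 0" for d y
  proof -
    \<comment> \<open>Padding by zeros turns coefficients on \<open>J\<close> into coefficients on
      \<open>I\<close>, the index set in \<open>neg\<close>.\<close>
    have "Q d x = (\<Sum>i\<in>I. (if i \<in> J then d i else 0) * f i x)" for x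
      unfolding Q_def by (intro sum.mono_neutral_cong_left) (use I \<open>J \<subseteq> I\<close> in auto)
    then show ?thesis using neg[of "\<lambda>i. if i \<in> J then d i else 0" y] that by simp
  qed
  have "\<exists>K. \<forall>x\<in>B. \<bar>f j x\<bar> \<le> K" if "j \<in> J" for j
  proof -
    have "compact (f j ` B)" using f that \<open>J \<subseteq> I\<close> B by (intro compact_continuous_image) auto
    then show ?thesis using compact_imp_bounded bounded_iff by (metis image_eqI real_norm_def)
  qed
  then obtain k where k: "\<And>j x. j \<in> J \<Longrightarrow> x \<in> B \<Longrightarrow> \<bar>f j x\<bar> \<le> k j" by metis
  \<comment> \<open>A common bound for all \<open>f j\<close> on \<open>B\<close>; the summand 1
    keeps it positive even for empty \<open>J\<close>, since it serves as a denominator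
    later.\<close>
  define K where "K = 1 + (\<Sum>j\<in>J. \<bar>k j\<bar>)"
  have "K > 0" unfolding K_def by (intro add_pos_nonneg sum_nonneg) auto
  have K: "\<bar>f j x\<bar> \<le> K" if "j \<in> J" "x \<in> B" for j x
  proof -
    have "\<bar>k j\<bar> \<le> (\<Sum>j\<in>J. \<bar>k j\<bar>)" using J that by (intro member_le_sum) auto
    then show ?thesis using k[OF that] by (simp add: K_def)
  qed
  have Q_le: "\<bar>Q d x\<bar> \<le> K * (\<Sum>j\<in>J. \<bar>d j\<bar>)" if "x \<in> B" for d x
  proof -
    have "\<bar>Q d x\<bar> \<le> (\<Sum>j\<in>J. \<bar>d j * f j x\<bar>)" unfolding Q_def by (rule sum_abs)
    also have "\<dots> \<le> (\<Sum>j\<in>J. K * \<bar>d j\<bar>)"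
      using K that by (intro sum_mono) (simp add: abs_mult mult.commute[of K] mult_left_mono)
    finally show ?thesis by (simp add: sum_distrib_left)
  qed
  \<comment> \<open>First the normalized case. If no level works, the levels 1 / (n + 1) give bad
    unit vectors, and these have a convergent subsequence whose limit \<open>l\<close> is again a
    unit vector.\<close>
  have "\<exists>\<epsilon>>0. \<forall>d. (\<Sum>j\<in>J. \<bar>d j\<bar>) = 1 \<longrightarrow> measure lebesgue {x\<in>B. \<bar>Q d x\<bar> < \<epsilon>} \<le> \<delta>"
  proof (rule ccontr)
    assume "\<not> ?thesis"
    then have *: "\<exists>d. (\<Sum>j\<in>J. \<bar>d j\<bar>) = 1 \<and> measure lebesgue {x\<in>B. \<bar>Q d x\<bar> < \<epsilon>} > \<delta>" if "\<epsilon> > 0" for \<epsilon>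
      using that unfolding not_le[symmetric] by blast
    have "\<exists>d. (\<Sum>j\<in>J. \<bar>d j\<bar>) = 1 \<and> measure lebesgue {x\<in>B. \<bar>Q d x\<bar> < 1 / Suc n} > \<delta>" for n :: nat
      by (rule *) simp
    then obtain d where d1: "\<And>n. (\<Sum>j\<in>J. \<bar>d n j\<bar>) = 1"
      and d: "\<And>n. measure lebesgue {x\<in>B. \<bar>Q (d n) x\<bar> < 1 / Suc n} > \<delta>"
      by metis
    have "\<bar>d n j\<bar> \<le> 1" if "j \<in> J" for n j
      using member_le_sum[OF that, of "\<lambda>j. \<bar>d n j\<bar>"] J d1 by auto
    then obtain r l where r: "strict_mono (r :: nat \<Rightarrow> nat)"
      and l: "\<And>j. j \<in> J \<Longrightarrow> (\<lambda>n. d (r n) j) \<longlonglongrightarrow> l j"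
      using finite_family_convergent_subseq[OF J, of d 1] by blast
    have "(\<lambda>n. \<Sum>j\<in>J. \<bar>d (r n) j\<bar>) \<longlonglongrightarrow> (\<Sum>j\<in>J. \<bar>l j\<bar>)"
      using l by (intro tendsto_sum tendsto_rabs)
    then have "(\<Sum>j\<in>J. \<bar>l j\<bar>) = 1" using d1 LIMSEQ_unique[OF _ tendsto_const] by simp
    then have "\<not> (\<forall>j\<in>J. l j = 0)" using sum.neutral[of J "\<lambda>j. \<bar>l j\<bar>"] by force
    then have "\<not> (\<forall>x. (\<Sum>j\<in>J. l j * f j x) = 0)" using ind[of l] by (rule contrapos_nn)
    then obtain y where y: "Q l y \<noteq> 0" unfolding Q_def by (elim not_all[THEN iffD1, THEN exE])
    then obtain \<epsilon> where "\<epsilon> > 0" and \<epsilon>: "measure lebesgue {x\<in>B. \<bar>Q l x\<bar> \<le> \<epsilon>} \<le> \<delta>"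
      using measure_sublevel_small[OF B Q_cont Q_neg[OF y] \<delta>] by (elim exE conjE)
    \<comment> \<open>By \<open>Q_le\<close>, the functions \<open>Q l\<close> and
      \<open>Q (d (r n))\<close> differ on \<open>B\<close> by at most \<open>K\<close> times the
      distance of their coefficients. Once this and the level 1 / (r n + 1) add up to less than
      \<epsilon>, the bad set lies in the sublevel set of the limit, contradicting its
      measure.\<close>
    have "(\<lambda>n. K * (\<Sum>j\<in>J. \<bar>l j - d (r n) j\<bar>)) \<longlonglongrightarrow> K * (\<Sum>j\<in>J. \<bar>l j - l j\<bar>)"
      using l by (intro tendsto_intros)
    then have "(\<lambda>n. K * (\<Sum>j\<in>J. \<bar>l j - d (r n) j\<bar>)) \<longlonglongrightarrow> 0" by simp
    moreover have "(\<lambda>n. 1 / Suc (r n)) \<longlonglongrightarrow> 0"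
      using LIMSEQ_subseq_LIMSEQ[OF LIMSEQ_inverse_real_of_nat r] by (simp add: o_def inverse_eq_divide)
    ultimately have "(\<lambda>n. K * (\<Sum>j\<in>J. \<bar>l j - d (r n) j\<bar>) + 1 / Suc (r n)) \<longlonglongrightarrow> 0"
      by (rule tendsto_add_zero)
    then have "\<forall>\<^sub>F n in sequentially. K * (\<Sum>j\<in>J. \<bar>l j - d (r n) j\<bar>) + 1 / Suc (r n) < \<epsilon>"
      using \<open>\<epsilon> > 0\<close> by (rule order_tendstoD)
    then obtain n where n: "K * (\<Sum>j\<in>J. \<bar>l j - d (r n) j\<bar>) + 1 / Suc (r n) < \<epsilon>"
      by (auto simp: eventually_sequentially)
    have "{x\<in>B. \<bar>Q (d (r n)) x\<bar> < 1 / Suc (r n)} \<subseteq> {x\<in>B. \<bar>Q l x\<bar> \<le> \<epsilon>}"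
    proof safe
      fix x assume x: "x \<in> B" "\<bar>Q (d (r n)) x\<bar> < 1 / Suc (r n)"
      have "Q l x - Q (d (r n)) x = Q (\<lambda>j. l j - d (r n) j) x"
        unfolding Q_def by (simp add: sum_subtractf left_diff_distrib)
      then show "\<bar>Q l x\<bar> \<le> \<epsilon>"
        using Q_le[OF x(1), of "\<lambda>j. l j - d (r n) j"] n x(2) by linarith
    qed
    then have "measure lebesgue {x\<in>B. \<bar>Q (d (r n)) x\<bar> < 1 / Suc (r n)}
      \<le> measure lebesgue {x\<in>B. \<bar>Q l x\<bar> \<le> \<epsilon>}"
      by (intro measure_mono_fmeasurable fmeasurableD lmeasurable_sublevel B Q_cont)
    with \<epsilon> have "measure lebesgue {x\<in>B. \<bar>Q (d (r n)) x\<bar> < 1 / Suc (r n)} \<le> \<delta>"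
      by (rule order_trans[rotated])
    then show False using d[of "r n"] by simp
  qed
  then obtain \<epsilon> where "\<epsilon> > 0"
    and \<epsilon>: "\<And>d. (\<Sum>j\<in>J. \<bar>d j\<bar>) = 1 \<Longrightarrow> measure lebesgue {x\<in>B. \<bar>Q d x\<bar> < \<epsilon>} \<le> \<delta>" by blast
  \<comment> \<open>The general case follows by homogeneity. Dividing \<epsilon> by \<open>K\<close>
    replaces the size of the coefficients by the value at \<open>z\<close>, which is at most
    \<open>K\<close> times that size.\<close>
  have est: "measure lebesgue {x\<in>B. \<bar>Q d x\<bar> < \<epsilon> / K * \<bar>Q d z\<bar>} \<le> \<delta>" if "z \<in> B" for d z
  proof (cases "(\<Sum>j\<in>J. \<bar>d j\<bar>) = 0")
    case True
    then have "Q d z = 0" using Q_le[OF that, of d] by simp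
    \<comment> \<open>The set is empty here because the inequality defining it is strict.\<close>
    then show ?thesis using \<delta> by simp
  next
    case False
    define s where "s = (\<Sum>j\<in>J. \<bar>d j\<bar>)"
    have "s > 0" using False unfolding s_def by (simp add: order_neq_le_trans sum_nonneg)
    have Qs: "Q (\<lambda>j. d j / s) x = Q d x / s" for x
      unfolding Q_def by (simp add: sum_divide_distrib)
    have "(\<Sum>j\<in>J. \<bar>d j / s\<bar>) = (\<Sum>j\<in>J. \<bar>d j\<bar>) / s" using \<open>s > 0\<close>
      by (simp add: sum_divide_distrib)
    then have *: "measure lebesgue {x\<in>B. \<bar>Q (\<lambda>j. d j / s) x\<bar> < \<epsilon>} \<le> \<delta>"
      using \<epsilon> \<open>s > 0\<close> by (simp add: s_def)
    have "{x\<in>B. \<bar>Q d x\<bar> < \<epsilon> / K * \<bar>Q d z\<bar>} \<subseteq> {x\<in>B. \<bar>Q (\<lambda>j. d j / s) x\<bar> < \<epsilon>}"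
    proof safe
      fix x assume x: "x \<in> B" "\<bar>Q d x\<bar> < \<epsilon> / K * \<bar>Q d z\<bar>"
      have "\<epsilon> / K * \<bar>Q d z\<bar> \<le> \<epsilon> / K * (K * s)"
        using Q_le[OF that, of d] \<open>\<epsilon> > 0\<close> \<open>K > 0\<close> by (intro mult_left_mono) (auto simp: s_def)
      then have "\<bar>Q d x\<bar> < \<epsilon> * s" using x(2) \<open>K > 0\<close> by simp
      then show "\<bar>Q (\<lambda>j. d j / s) x\<bar> < \<epsilon>"
        using \<open>s > 0\<close> by (simp add: Qs divide_less_eq)
    qed
    then have "measure lebesgue {x\<in>B. \<bar>Q d x\<bar> < \<epsilon> / K * \<bar>Q d z\<bar>}
      \<le> measure lebesgue {x\<in>B. \<bar>Q (\<lambda>j. d j / s) x\<bar> < \<epsilon>}"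
      by (intro measure_mono_fmeasurable fmeasurableD lmeasurable_sublevel B Q_cont)
    with * show ?thesis by (rule order_trans[rotated])
  qed
  have "measure lebesgue {x\<in>B. \<bar>\<Sum>i\<in>I. c i * f i x\<bar> < \<epsilon> / K * \<bar>\<Sum>i\<in>I. c i * f i z\<bar>} \<le> \<delta>"
    if "z \<in> B" for c z
  proof -
    obtain d where "\<forall>x. (\<Sum>i\<in>I. c i * f i x) = (\<Sum>j\<in>J. d j * f j x)"
      using JI[of c] by (elim exE)
    then have d: "(\<Sum>i\<in>I. c i * f i x) = Q d x" for x
      unfolding Q_def by (rule spec)
    show ?thesis unfolding d by (rule est) (rule that)
  qed
  moreover have "\<epsilon> / K > 0" using \<open>\<epsilon> > 0\<close> \<open>K > 0\<close> by simp
  ultimately show ?thesis by (intro exI[of _ "\<epsilon> / K"] conjI allI ballI)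
qed

section \<open>The polynomial spaces\<close>

lemma finite_multi_indices: "finite {\<mu> :: 'd::finite \<Rightarrow> nat. sum \<mu> UNIV \<le> k}"
proof (rule finite_subset)
  show "{\<mu> :: 'd \<Rightarrow> nat. sum \<mu> UNIV \<le> k} \<subseteq> UNIV \<rightarrow>\<^sub>E {..k}"
    by (auto simp: PiE_def intro: order_trans[OF member_le_sum[of _ UNIV]])
  show "finite (UNIV \<rightarrow>\<^sub>E {..k} :: ('d \<Rightarrow> nat) set)" by (intro finite_PiE) auto
qed

lemma poly_spaceE:
  assumes "p \<in> poly_space k"
  obtains c where "\<And>x. p x = (\<Sum>\<mu> | sum \<mu> UNIV \<le> k. c \<mu> * monomial_fun \<mu> x)"
  using assms unfolding poly_space_def by auto

lemma poly_space_linear_combination: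
  assumes "p \<in> poly_space k" "q \<in> poly_space k"
  shows "(\<lambda>x. s * p x + t * q x) \<in> poly_space k"
proof -
  obtain c where c: "\<And>x. p x = (\<Sum>\<mu> | sum \<mu> UNIV \<le> k. c \<mu> * monomial_fun \<mu> x)"
    using poly_spaceE[OF assms(1)] by blast
  obtain d where d: "\<And>x. q x = (\<Sum>\<mu> | sum \<mu> UNIV \<le> k. d \<mu> * monomial_fun \<mu> x)"
    using poly_spaceE[OF assms(2)] by blast
  have "(\<lambda>x. s * p x + t * q x)
      = (\<lambda>x. \<Sum>\<mu> | sum \<mu> UNIV \<le> k. (s * c \<mu> + t * d \<mu>) * monomial_fun \<mu> x)"
    unfolding c d by (simp add: sum.distrib sum_distrib_left distrib_right mult.assoc)
  then show ?thesis unfolding poly_space_def by (intro CollectI exI)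
qed

lemma poly_space_zero: "(\<lambda>x. 0) \<in> poly_space k"
  unfolding poly_space_def by (intro CollectI exI[of _ "\<lambda>_. 0"]) simp

lemma poly_space_diff:
  assumes "p \<in> poly_space k" "q \<in> poly_space k"
  shows "(\<lambda>x. p x - q x) \<in> poly_space k"
  using poly_space_linear_combination[OF assms, of 1 "-1"] by simp

lemma poly_space_cmult: "p \<in> poly_space k \<Longrightarrow> (\<lambda>x. s * p x) \<in> poly_space k"
  using poly_space_linear_combination[of p k p s 0] by simp

lemma monomial_fun_in_poly_space:
  fixes \<mu> :: "'d::finite \<Rightarrow> nat"
  assumes "sum \<mu> UNIV \<le> k"
  shows "monomial_fun \<mu> \<in> poly_space k"
  unfolding poly_space_def
  using assms finite_multi_indices[where ?'d = 'd, of k]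
  by (intro CollectI exI[of _ "\<lambda>\<nu>. if \<nu> = \<mu> then 1 else 0"])
    (simp add: if_distrib[of "\<lambda>c. c * _"] cong: if_cong)

text \<open>Adding one monomial term at a time reaches every polynomial, so a property stable under
  s * p + q need only be checked on monomials. This reduces products, affine substitution and
  differentiation to monomials.\<close>

lemma poly_space_induct:
  fixes p :: "real ^ 'd \<Rightarrow> real"
  assumes "p \<in> poly_space k" and "\<And>\<mu>. sum \<mu> UNIV \<le> k \<Longrightarrow> P (\<lambda>x. monomial_fun \<mu> x)"
    and "P (\<lambda>x. 0)" and "\<And>p q s. P p \<Longrightarrow> P q \<Longrightarrow> P (\<lambda>x. s * p x + q x)"
  shows "P p"
proof -
  obtain c where c: "\<And>x. p x = (\<Sum>\<mu> | sum \<mu> UNIV \<le> k. c \<mu> * monomial_fun \<mu> x)"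
    using poly_spaceE[OF assms(1)] by blast
  have "P (\<lambda>x. \<Sum>\<mu>\<in>I. c \<mu> * monomial_fun \<mu> x)" if "I \<subseteq> {\<mu>. sum \<mu> UNIV \<le> k}" for I
    using that
  proof (induction I rule: infinite_finite_induct)
    case (insert \<mu> I)
    then show ?case
      using assms(4)[OF assms(2)[of \<mu>], of "\<lambda>x. \<Sum>\<mu>\<in>I. c \<mu> * monomial_fun \<mu> x" "c \<mu>"] by simp
  qed (use assms(3) in simp_all)
  moreover have "p = (\<lambda>x. \<Sum>\<mu> | sum \<mu> UNIV \<le> k. c \<mu> * monomial_fun \<mu> x)"
    using c by (rule ext)
  ultimately show ?thesis by simp
qed

text \<open>By bilinearity, one induction for each factor leaves the product of two monomials, whose
  exponents add.\<close>

lemma poly_space_mult: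
  fixes p q :: "real ^ 'd \<Rightarrow> real"
  assumes "p \<in> poly_space j" "q \<in> poly_space k"
  shows "(\<lambda>x. p x * q x) \<in> poly_space (j + k)"
  using assms(1)
proof (rule poly_space_induct)
  fix \<mu> :: "'d \<Rightarrow> nat" assume \<mu>: "sum \<mu> UNIV \<le> j"
  show "(\<lambda>x. monomial_fun \<mu> x * q x) \<in> poly_space (j + k)"
    using assms(2)
  proof (rule poly_space_induct)
    fix \<nu> :: "'d \<Rightarrow> nat" assume "sum \<nu> UNIV \<le> k"
    then have "monomial_fun (\<lambda>i. \<mu> i + \<nu> i) \<in> poly_space (j + k)"
      using \<mu> by (intro monomial_fun_in_poly_space) (simp add: sum.distrib)
    then show "(\<lambda>x. monomial_fun \<mu> x * monomial_fun \<nu> x) \<in> poly_space (j + k)"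
      by (simp add: monomial_fun_def[abs_def] power_add prod.distrib)
  next
    fix p q s
    assume "(\<lambda>x. monomial_fun \<mu> x * p x) \<in> poly_space (j + k)"
      and "(\<lambda>x. monomial_fun \<mu> x * q x) \<in> poly_space (j + k)"
    from poly_space_linear_combination[OF this, of s 1]
    show "(\<lambda>x. monomial_fun \<mu> x * (s * p x + q x)) \<in> poly_space (j + k)"
      by (simp add: algebra_simps)
  qed (simp add: poly_space_zero)
next
  fix p r s
  assume "(\<lambda>x. p x * q x) \<in> poly_space (j + k)" and "(\<lambda>x. r x * q x) \<in> poly_space (j + k)"
  from poly_space_linear_combination[OF this, of s 1]
  show "(\<lambda>x. (s * p x + r x) * q x) \<in> poly_space (j + k)"
    by (simp add: algebra_simps)
qed (simp add: poly_space_zero)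

lemma poly_space_const: "(\<lambda>x. c) \<in> poly_space k"
  using poly_space_cmult[OF monomial_fun_in_poly_space[of "\<lambda>_. 0" k], of c]
  by (simp add: monomial_fun_def)

text \<open>The constant 1 counts as a polynomial of degree at most \<open>k - j\<close>, so
  multiplying by it raises the degree bound from \<open>j\<close> to \<open>k\<close>.\<close>

lemma poly_space_mono: "p \<in> poly_space j \<Longrightarrow> j \<le> k \<Longrightarrow> p \<in> poly_space k"
  using poly_space_mult[OF _ poly_space_const, of p j 1 "k - j"] by simp

lemma poly_space_component: "(\<lambda>x. x $ i) \<in> poly_space 1"
proof -
  have "monomial_fun (\<lambda>j. if j = i then 1 else 0) \<in> poly_space 1"
    by (intro monomial_fun_in_poly_space) simp
  moreover have "monomial_fun (\<lambda>j. if j = i then 1 else 0) = (\<lambda>x. x $ i)"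
    by (simp add: monomial_fun_def[abs_def] if_distrib cong: if_cong)
  ultimately show ?thesis by simp
qed

lemma poly_space_power: "p \<in> poly_space j \<Longrightarrow> (\<lambda>x. p x ^ n) \<in> poly_space (n * j)"
  by (induction n) (use poly_space_const in \<open>auto dest: poly_space_mult\<close>)

lemma poly_space_prod:
  "finite A \<Longrightarrow> (\<And>i. i \<in> A \<Longrightarrow> p i \<in> poly_space (n i)) \<Longrightarrow>
    (\<lambda>x. \<Prod>i\<in>A. p i x) \<in> poly_space (\<Sum>i\<in>A. n i)"
  by (induction A rule: finite_induct) (auto simp: poly_space_const intro: poly_space_mult)

text \<open>Each coordinate becomes a polynomial of degree at most 1, so a monomial turns into a
  product with the same total degree bound. This lets estimates on a reference ball be transported
  to every centre and every scale.\<close>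

lemma poly_space_affine:
  fixes p :: "real ^ 'd \<Rightarrow> real"
  assumes "p \<in> poly_space k"
  shows "(\<lambda>x. p (a + t *\<^sub>R x)) \<in> poly_space k"
  using assms
proof (rule poly_space_induct)
  fix \<mu> :: "'d \<Rightarrow> nat" assume \<mu>: "sum \<mu> UNIV \<le> k"
  have "(\<lambda>x. a $ i + t * x $ i) \<in> poly_space 1" for i
    using poly_space_linear_combination[OF poly_space_const[of 1] poly_space_component, of "a $ i" t i] by simp
  then have "(\<lambda>x. (a $ i + t * x $ i) ^ \<mu> i) \<in> poly_space (\<mu> i)" for i
    using poly_space_power[where j = 1] by fastforce
  then have "(\<lambda>x. \<Prod>i\<in>UNIV. (a $ i + t * x $ i) ^ \<mu> i) \<in> poly_space (sum \<mu> UNIV)"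
    by (intro poly_space_prod) auto
  then show "(\<lambda>x. monomial_fun \<mu> (a + t *\<^sub>R x)) \<in> poly_space k"
    using \<mu> by (simp add: monomial_fun_def poly_space_mono)
next
  fix p q :: "real ^ 'd \<Rightarrow> real" and s
  assume "(\<lambda>x. p (a + t *\<^sub>R x)) \<in> poly_space k" and "(\<lambda>x. q (a + t *\<^sub>R x)) \<in> poly_space k"
  from poly_space_linear_combination[OF this, of s 1]
  show "(\<lambda>x. s * p (a + t *\<^sub>R x) + q (a + t *\<^sub>R x)) \<in> poly_space k" by simp
qed (simp add: poly_space_zero)

section \<open>Regularity of polynomials and their gradients\<close>

lemma real_polynomial_function_poly_space:
  fixes p :: "real ^ 'd \<Rightarrow> real"
  assumes "p \<in> poly_space k"
  shows "real_polynomial_function p"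
  using assms
proof (rule poly_space_induct)
  fix \<mu> :: "'d \<Rightarrow> nat"
  show "real_polynomial_function (\<lambda>x. monomial_fun \<mu> x)"
    unfolding monomial_fun_def
    by (intro real_polynomial_function_prod real_polynomial_function_power
        real_polynomial_function.intros(1) bounded_linear_vec_nth) simp
qed (simp_all add: real_polynomial_function.intros)

lemma continuous_on_poly_space:
  fixes p :: "real ^ 'd \<Rightarrow> real"
  assumes "p \<in> poly_space k"
  shows "continuous_on S p"
  using real_polynomial_function_poly_space[OF assms]
  by (simp add: continuous_on_polymonial_function real_polynomial_function_eq)

lemma poly_space_differentiable:
  fixes p :: "real ^ 'd \<Rightarrow> real"
  assumes "p \<in> poly_space k"
  shows "p differentiable at x"
  using real_polynomial_function_poly_space[OF assms]
  by (simp add: differentiable_at_polynomial_function real_polynomial_function_eq)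

lemma grad_nth_eq: "(v has_derivative D) (at x) \<Longrightarrow> grad v x $ l = D (axis l 1)"
  using frechet_derivative_at[of v D x] by (simp add: grad_def)

lemma grad_poly_space:
  fixes p :: "real ^ 'd \<Rightarrow> real"
  assumes "p \<in> poly_space k"
  shows "(\<lambda>x. grad p x $ l) \<in> poly_space k"
proof -
  \<comment> \<open>Membership of \<open>p\<close> itself is carried along because the step for s *
    p + q needs both functions to be differentiable.\<close>
  have "p \<in> poly_space k \<and> (\<lambda>x. grad p x $ l) \<in> poly_space k"
    using assms
  proof (rule poly_space_induct)
    fix \<mu> :: "'d \<Rightarrow> nat" assume \<mu>: "sum \<mu> UNIV \<le> k"
    have "((\<lambda>x. monomial_fun \<mu> x) has_derivative
        (\<lambda>y. \<Sum>i\<in>UNIV. (of_nat (\<mu> i) * y $ i * x $ i ^ (\<mu> i - 1)) * (\<Prod>j\<in>UNIV - {i}. x $ j ^ \<mu> j))) (at x)" for x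
      unfolding monomial_fun_def
      by (intro has_derivative_prod has_derivative_power bounded_linear_imp_has_derivative bounded_linear_vec_nth)
    then have "grad (\<lambda>x. monomial_fun \<mu> x) x $ l
        = (\<Sum>i\<in>UNIV. (of_nat (\<mu> i) * axis l 1 $ i * x $ i ^ (\<mu> i - 1)) * (\<Prod>j\<in>UNIV - {i}. x $ j ^ \<mu> j))" for x
      by (rule grad_nth_eq)
    also have "\<dots> x = of_nat (\<mu> l) * (x $ l ^ (\<mu> l - 1) * (\<Prod>j\<in>UNIV - {l}. x $ j ^ \<mu> j))" for x
      by (subst sum.remove[of _ l]) (auto simp: axis_def)
    finally have eq: "(\<lambda>x. grad (\<lambda>x. monomial_fun \<mu> x) x $ l)
        = (\<lambda>x. of_nat (\<mu> l) * (x $ l ^ (\<mu> l - 1) * (\<Prod>j\<in>UNIV - {l}. x $ j ^ \<mu> j)))"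
      by (rule ext)
    have pow: "(\<lambda>x :: real ^ 'd. x $ j ^ n) \<in> poly_space n" for j n
      using poly_space_power[OF poly_space_component] by fastforce
    have "(\<lambda>x. \<Prod>j\<in>UNIV - {l}. x $ j ^ \<mu> j) \<in> poly_space (\<Sum>j\<in>UNIV - {l}. \<mu> j)"
      by (intro poly_space_prod pow) simp
    from poly_space_cmult[OF poly_space_mult[OF pow this]]
    have "(\<lambda>x. of_nat (\<mu> l) * (x $ l ^ (\<mu> l - 1) * (\<Prod>j\<in>UNIV - {l}. x $ j ^ \<mu> j)))
        \<in> poly_space ((\<mu> l - 1) + (\<Sum>j\<in>UNIV - {l}. \<mu> j))" .
    \<comment> \<open>For \<open>\<mu> l = 0\<close> the truncated exponent is 0 and the bound still
      holds; the derivative is then zero through the factor \<open>of_nat (\<mu> l)\<close>.\<close>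
    moreover have "(\<mu> l - 1) + (\<Sum>j\<in>UNIV - {l}. \<mu> j) \<le> k"
      using \<mu> sum.remove[of UNIV l \<mu>] by simp
    ultimately have "(\<lambda>x. grad (\<lambda>x. monomial_fun \<mu> x) x $ l) \<in> poly_space k"
      unfolding eq by (rule poly_space_mono)
    then show "(\<lambda>x. monomial_fun \<mu> x) \<in> poly_space k
        \<and> (\<lambda>x. grad (\<lambda>x. monomial_fun \<mu> x) x $ l) \<in> poly_space k"
      using monomial_fun_in_poly_space[OF \<mu>] by simp
  next
    have "grad (\<lambda>x :: real ^ 'd. 0) x $ l = 0" for x
      by (simp add: grad_def)
    then show "(\<lambda>x. 0) \<in> poly_space k \<and> (\<lambda>x. grad (\<lambda>x :: real ^ 'd. 0) x $ l) \<in> poly_space k"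
      by (simp add: poly_space_zero)
  next
    fix p q :: "real ^ 'd \<Rightarrow> real" and s
    assume p: "p \<in> poly_space k \<and> (\<lambda>x. grad p x $ l) \<in> poly_space k"
      and q: "q \<in> poly_space k \<and> (\<lambda>x. grad q x $ l) \<in> poly_space k"
    have "((\<lambda>x. s * p x + q x) has_derivative
        (\<lambda>y. s * frechet_derivative p (at x) y + frechet_derivative q (at x) y)) (at x)" for x
      using p q by (intro has_derivative_add has_derivative_mult_right)
        (auto simp: frechet_derivative_works[symmetric] intro: poly_space_differentiable)
    from grad_nth_eq[OF this]
    have "grad (\<lambda>x. s * p x + q x) x $ l = s * grad p x $ l + 1 * grad q x $ l" for x
      by (simp add: grad_def)
    then show "(\<lambda>x. s * p x + q x) \<in> poly_space k
        \<and> (\<lambda>x. grad (\<lambda>x. s * p x + q x) x $ l) \<in> poly_space k"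
      using p q poly_space_linear_combination[of p k q s 1] 
        poly_space_linear_combination[of "\<lambda>x. grad p x $ l" k "\<lambda>x. grad q x $ l" s 1] by simp
  qed
  then show ?thesis ..
qed

section \<open>Null zero sets and the canonical extension\<close>

lemma negligible_zeros_poly_space:
  fixes p :: "real ^ 'd \<Rightarrow> real"
  assumes "p \<in> poly_space k" and "p a \<noteq> 0"
  shows "negligible {x. p x = 0}"
  using assms by (intro negligible_zeros_real_polynomial_function real_polynomial_function_poly_space)

text \<open>Otherwise the difference is a nonzero polynomial, whose zero set is null and yet
  contains \<open>T\<close>.\<close>

lemma poly_space_eqI:
  fixes p q :: "real ^ 'd \<Rightarrow> real"
  assumes "p \<in> poly_space k" "q \<in> poly_space k"
    and "\<And>x. x \<in> T \<Longrightarrow> p x = q x" and "\<not> negligible T"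
  shows "p = q"
proof (rule ccontr)
  assume "p \<noteq> q"
  then obtain a where "p a - q a \<noteq> 0" by (auto simp: fun_eq_iff)
  then have "negligible {x. p x - q x = 0}"
    using assms(1,2) by (intro negligible_zeros_poly_space[OF poly_space_diff])
  then have "negligible T"
    by (rule negligible_subset) (use assms(3) in auto)
  with assms(4) show False ..
qed

text \<open>Uniqueness on a set that is not null justifies the definite description in
  \<open>canonical_ext\<close>, which can then be replaced by any polynomial known to agree with
  \<open>v\<close> on \<open>T\<close>.\<close>

lemma canonical_ext_eqI:
  fixes v p :: "real ^ 'd \<Rightarrow> real"
  assumes p: "p \<in> poly_space k" "\<And>x. x \<in> T \<Longrightarrow> v x = p x" and T: "\<not> negligible T"
  shows "canonical_ext k v T = p"
  unfolding canonical_ext_def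
proof (rule the_equality)
  fix q assume "q \<in> poly_space k \<and> (\<forall>x\<in>T. q x = v x)"
  then show "q = p" using p by (intro poly_space_eqI[OF _ p(1) _ T]) auto
qed (use p in auto)

section \<open>Comparison of integrals of one polynomial over two subsets of a ball\<close>

lemma poly_space_sublevel_estimate:
  fixes R \<delta> :: real
  assumes "\<delta> > 0"
  shows "\<exists>\<epsilon>>0. \<forall>p \<in> poly_space k. \<forall>a :: real ^ 'd. \<forall>h>0. \<forall>z\<in>cball a (R * h).
    measure lebesgue {x\<in>cball a (R * h). \<bar>p x\<bar> < \<epsilon> * \<bar>p z\<bar>} \<le> \<delta> * h ^ CARD('d)"
proof -
  let ?I = "{\<mu> :: 'd \<Rightarrow> nat. sum \<mu> UNIV \<le> k}"
  have "\<exists>\<epsilon>>0. \<forall>c. \<forall>z\<in>cball 0 R. measure lebesgue {x\<in>cball 0 R.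
      \<bar>\<Sum>\<mu>\<in>?I. c \<mu> * monomial_fun \<mu> x\<bar> < \<epsilon> * \<bar>\<Sum>\<mu>\<in>?I. c \<mu> * monomial_fun \<mu> z\<bar>} \<le> \<delta>"
  proof (rule uniform_sublevel_estimate)
    show "finite ?I" by (rule finite_multi_indices)
    show "continuous_on (cball 0 R) (monomial_fun \<mu>)" if "\<mu> \<in> ?I" for \<mu>
      using that by (intro continuous_on_poly_space[OF monomial_fun_in_poly_space]) simp
  next
    fix c :: "('d \<Rightarrow> nat) \<Rightarrow> real" and y :: "real ^ 'd"
    assume y: "(\<Sum>\<mu>\<in>?I. c \<mu> * monomial_fun \<mu> y) \<noteq> 0"
    have "(\<lambda>x. \<Sum>\<mu>\<in>?I. c \<mu> * monomial_fun \<mu> x) \<in> poly_space k"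
      unfolding poly_space_def by (intro CollectI exI) (rule refl)
    from negligible_zeros_poly_space[OF this y]
    show "negligible {x\<in>cball 0 R. (\<Sum>\<mu>\<in>?I. c \<mu> * monomial_fun \<mu> x) = 0}"
      by (rule negligible_subset) auto
  qed (use assms in auto)
  then obtain \<epsilon> where "\<epsilon> > 0" and est: "\<forall>c. \<forall>z\<in>cball 0 R. measure lebesgue {x\<in>cball 0 R.
      \<bar>\<Sum>\<mu>\<in>?I. c \<mu> * monomial_fun \<mu> x\<bar> < \<epsilon> * \<bar>\<Sum>\<mu>\<in>?I. c \<mu> * monomial_fun \<mu> z\<bar>} \<le> \<delta>"
    by (elim exE conjE)
  have \<epsilon>: "measure lebesgue {x\<in>cball 0 R.
      \<bar>\<Sum>\<mu>\<in>?I. c \<mu> * monomial_fun \<mu> x\<bar> < \<epsilon> * \<bar>\<Sum>\<mu>\<in>?I. c \<mu> * monomial_fun \<mu> z\<bar>} \<le> \<delta>"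
    if "z \<in> cball 0 R" for c z
    using est[rule_format, OF that] .
  \<comment> \<open>Scaling by \<open>h\<close> and shifting by \<open>a\<close> maps the reference
    ball onto the given one and multiplies measures by the \<open>d\<close>-th power of
    \<open>h\<close>. The pulled back polynomial is in the same space, so the same \<epsilon>
    works.\<close>
  have "measure lebesgue {x\<in>cball a (R * h). \<bar>p x\<bar> < \<epsilon> * \<bar>p z\<bar>} \<le> \<delta> * h ^ CARD('d)"
    if p: "p \<in> poly_space k" and h: "h > 0" and z: "z \<in> cball a (R * h)"
    for p and a z :: "real ^ 'd" and h
  proof -
    obtain c where c: "\<And>x. p (a + h *\<^sub>R x) = (\<Sum>\<mu>\<in>?I. c \<mu> * monomial_fun \<mu> x)"
      using poly_spaceE[OF poly_space_affine[OF p]] by blast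
    have in_cball: "h *\<^sub>R x + a \<in> cball a (R * h) \<longleftrightarrow> x \<in> cball 0 R" for x
      using h by (simp add: dist_norm mult.commute)
    define A where "A = {x\<in>cball 0 R. \<bar>p (a + h *\<^sub>R x)\<bar> < \<epsilon> * \<bar>p z\<bar>}"
    have inv: "h *\<^sub>R ((x - a) /\<^sub>R h) + a = x" for x using h by simp
    have "{x\<in>cball a (R * h). \<bar>p x\<bar> < \<epsilon> * \<bar>p z\<bar>} = (\<lambda>x. h *\<^sub>R x + a) ` A"
    proof (intro equalityI subsetI)
      fix x assume x: "x \<in> {x\<in>cball a (R * h). \<bar>p x\<bar> < \<epsilon> * \<bar>p z\<bar>}"
      then have "(x - a) /\<^sub>R h \<in> A"
        using in_cball[of "(x - a) /\<^sub>R h"] inv[of x] by (simp add: A_def add.commute[of a])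
      then show "x \<in> (\<lambda>x. h *\<^sub>R x + a) ` A" using inv[of x] by (intro image_eqI[of _ _ "(x - a) /\<^sub>R h"]) simp_all
    next
      fix x assume "x \<in> (\<lambda>x. h *\<^sub>R x + a) ` A"
      then obtain y where "x = h *\<^sub>R y + a" "y \<in> A" by blast
      then show "x \<in> {x\<in>cball a (R * h). \<bar>p x\<bar> < \<epsilon> * \<bar>p z\<bar>}"
        using in_cball[of y] by (simp add: A_def add.commute[of a])
    qed
    then have "measure lebesgue {x\<in>cball a (R * h). \<bar>p x\<bar> < \<epsilon> * \<bar>p z\<bar>}
        = h ^ CARD('d) * measure lebesgue A"
      using h by (simp add: measure_lebesgue_affine)
    also have "A = {x\<in>cball 0 R. \<bar>p (a + h *\<^sub>R x)\<bar> < \<epsilon> * \<bar>p (a + h *\<^sub>R ((z - a) /\<^sub>R h))\<bar>}"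
      using inv[of z] by (simp add: A_def add.commute[of a])
    also have "measure lebesgue \<dots> \<le> \<delta>"
      unfolding c using z in_cball[of "(z - a) /\<^sub>R h"] inv[of z] by (intro \<epsilon>) simp
    finally show ?thesis using h by (simp add: mult.commute)
  qed
  with \<open>\<epsilon> > 0\<close> show ?thesis by (intro exI[of _ \<epsilon>] conjI ballI allI impI)
qed

lemma set_integrable_lebesgue_continuous:
  fixes f :: "'a::euclidean_space \<Rightarrow> real"
  assumes "compact B" "continuous_on B f" "S \<in> sets lebesgue" "S \<subseteq> B"
  shows "set_integrable lebesgue S f"
proof (rule set_integrable_subset)
  have "integrable lborel (\<lambda>x. indicator B x *\<^sub>R f x)"
    using assms by (intro borel_integrable_compact)
  then show "set_integrable lebesgue B f"
    unfolding set_integrable_def by (simp add: integrable_completion)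
qed (use assms in auto)

text \<open>Let the maximum of \<bar>p\<bar> over the ball be attained at \<open>z\<close>. Removing
  from \<open>E\<close> the points where \<bar>p\<bar> is below \<epsilon> times this maximum costs
  at most half of the measure guaranteed for \<open>E\<close>. The remaining part bounds the
  integral over \<open>E\<close> from below by a multiple of the squared maximum, and the volume of
  the ball bounds the integral over \<open>T\<close> from above.\<close>

lemma poly_space_l2_comparison:
  fixes R \<delta> :: real
  assumes "\<delta> > 0" "R > 0"
  shows "\<exists>C\<ge>0. \<forall>p \<in> poly_space k. \<forall>a :: real ^ 'd. \<forall>h>0. \<forall>T E.
    T \<in> sets lebesgue \<longrightarrow> E \<in> sets lebesgue \<longrightarrow> T \<subseteq> cball a (R * h) \<longrightarrow> E \<subseteq> cball a (R * h) \<longrightarrow>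
    \<delta> * h ^ CARD('d) \<le> measure lebesgue E \<longrightarrow>
    (LINT x:T|lebesgue. (p x)\<^sup>2) \<le> C * (LINT x:E|lebesgue. (p x)\<^sup>2)"
proof -
  have "\<delta> / 2 > 0" using assms by simp
  from poly_space_sublevel_estimate[where ?'d = 'd, OF this, of k R]
  obtain \<epsilon> where "\<epsilon> > 0" and est: "\<forall>p \<in> poly_space k. \<forall>a :: real ^ 'd. \<forall>h>0. \<forall>z\<in>cball a (R * h).
      measure lebesgue {x\<in>cball a (R * h). \<bar>p x\<bar> < \<epsilon> * \<bar>p z\<bar>} \<le> \<delta> / 2 * h ^ CARD('d)"
    by (elim exE conjE)
  have \<epsilon>: "measure lebesgue {x\<in>cball a (R * h). \<bar>p x\<bar> < \<epsilon> * \<bar>p z\<bar>} \<le> \<delta> / 2 * h ^ CARD('d)"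
    if "p \<in> poly_space k" "h > 0" "z \<in> cball a (R * h)" for p and a z :: "real ^ 'd" and h
    using est[rule_format, OF that] .
  define V where "V = measure lebesgue (cball (0 :: real ^ 'd) 1)"
  \<comment> \<open>The quotient of the upper bound for \<open>T\<close> by the lower bound for
    \<open>E\<close>; the powers of \<open>h\<close> and the squared maximum cancel.\<close>
  define C where "C = V * R ^ CARD('d) / (\<epsilon>\<^sup>2 * (\<delta> / 2))"
  have "V \<ge> 0" unfolding V_def by simp
  then have "C \<ge> 0" unfolding C_def using assms by simp
  moreover have "(LINT x:T|lebesgue. (p x)\<^sup>2) \<le> C * (LINT x:E|lebesgue. (p x)\<^sup>2)"
    if p: "p \<in> poly_space k" and h: "h > 0"
      and T: "T \<in> sets lebesgue" "T \<subseteq> cball a (R * h)"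
      and E: "E \<in> sets lebesgue" "E \<subseteq> cball a (R * h)"
      and E_large: "\<delta> * h ^ CARD('d) \<le> measure lebesgue E"
    for p and a :: "real ^ 'd" and h T E
  proof -
    let ?B = "cball a (R * h)"
    have integrable: "set_integrable lebesgue S (\<lambda>x. (p x)\<^sup>2)" if "S \<in> sets lebesgue" "S \<subseteq> ?B" for S
      using that by (intro set_integrable_lebesgue_continuous[OF compact_cball]
          continuous_intros continuous_on_poly_space[OF p])
    have lmeas: "S \<in> lmeasurable" if "S \<in> sets lebesgue" "S \<subseteq> ?B" for S
      using that by (intro fmeasurableI2[OF lmeasurable_cball])
    have const: "(LINT x:S|lebesgue. c) = c * measure lebesgue S"
      and const_int: "set_integrable lebesgue S (\<lambda>_. c)"
      if "S \<in> sets lebesgue" "S \<subseteq> ?B" for S and c :: real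
      using set_integral_const[OF that(1), of c] fmeasurableD2[OF lmeas[OF that]]
        set_integrable_lebesgue_continuous[OF compact_cball continuous_on_const that]
      by simp_all
    have "continuous_on ?B (\<lambda>x. \<bar>p x\<bar>)"
      by (intro continuous_intros continuous_on_poly_space[OF p])
    moreover have "?B \<noteq> {}" using mult_pos_pos[OF \<open>R > 0\<close> h] by simp
    ultimately obtain z where z: "z \<in> ?B" "\<And>x. x \<in> ?B \<Longrightarrow> \<bar>p x\<bar> \<le> \<bar>p z\<bar>"
      using continuous_attains_sup[OF compact_cball] by blast
    define L where "L = {x\<in>?B. \<bar>p x\<bar> < \<epsilon> * \<bar>p z\<bar>}"
    have L: "L \<in> lmeasurable"
      unfolding L_def by (intro lmeasurable_sublevel compact_cball continuous_on_poly_space[OF p])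
    have G: "E - L \<in> sets lebesgue" "E - L \<subseteq> ?B"
      using E L by (auto intro: fmeasurableD)
    have "measure lebesgue E \<le> measure lebesgue (E - L) + measure lebesgue L"
    proof -
      have "measure lebesgue E \<le> measure lebesgue ((E - L) \<union> L)"
        using lmeas[OF G] lmeas[OF E] L E by (intro measure_mono_fmeasurable) auto
      also have "\<dots> \<le> measure lebesgue (E - L) + measure lebesgue L"
        using G L by (intro measure_Un_le) auto
      finally show ?thesis .
    qed
    then have G_large: "\<delta> / 2 * h ^ CARD('d) \<le> measure lebesgue (E - L)"
      using \<epsilon>[OF p h z(1)] E_large unfolding L_def by simp
    have "(\<epsilon> * \<bar>p z\<bar>)\<^sup>2 * (\<delta> / 2 * h ^ CARD('d)) \<le> (\<epsilon> * \<bar>p z\<bar>)\<^sup>2 * measure lebesgue (E - L)"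
      using G_large by (intro mult_left_mono) auto
    also have "\<dots> = (LINT x:E - L|lebesgue. (\<epsilon> * \<bar>p z\<bar>)\<^sup>2)"
      using const[OF G] by simp
    also have "\<dots> \<le> (LINT x:E - L|lebesgue. (p x)\<^sup>2)"
    proof (intro set_integral_mono const_int integrable G)
      fix x assume "x \<in> E - L"
      then have "\<epsilon> * \<bar>p z\<bar> \<le> \<bar>p x\<bar>" using E by (auto simp: L_def not_less)
      then show "(\<epsilon> * \<bar>p z\<bar>)\<^sup>2 \<le> (p x)\<^sup>2"
        using \<open>\<epsilon> > 0\<close> power_mono[of "\<epsilon> * \<bar>p z\<bar>" "\<bar>p x\<bar>" 2] by simp
    qed
    also have "\<dots> \<le> (LINT x:E|lebesgue. (p x)\<^sup>2)"
      using integrable[OF G] integrable[OF E] unfolding set_integrable_def set_lebesgue_integral_def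
      by (intro integral_mono) (auto simp: indicator_def)
    finally have lower: "(\<epsilon> * \<bar>p z\<bar>)\<^sup>2 * (\<delta> / 2 * h ^ CARD('d)) \<le> (LINT x:E|lebesgue. (p x)\<^sup>2)" .
    have "(LINT x:T|lebesgue. (p x)\<^sup>2) \<le> (LINT x:T|lebesgue. (p z)\<^sup>2)"
    proof (intro set_integral_mono const_int integrable T)
      fix x assume "x \<in> T"
      then show "(p x)\<^sup>2 \<le> (p z)\<^sup>2" using z(2)[of x] T power_mono[of "\<bar>p x\<bar>" "\<bar>p z\<bar>" 2] by auto
    qed
    also have "\<dots> = (p z)\<^sup>2 * measure lebesgue T" using const[OF T] by simp
    also have "\<dots> \<le> (p z)\<^sup>2 * measure lebesgue ?B"
      using T by (intro mult_left_mono measure_mono_fmeasurable) auto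
    also have "measure lebesgue ?B = V * (R * h) ^ CARD('d)"
      using assms h content_ball_conv_unit_ball[of "R * h" a]
      by (simp add: V_def content_cball_conv_ball mult.commute)
    also have "(p z)\<^sup>2 * (V * (R * h) ^ CARD('d)) = C * ((\<epsilon> * \<bar>p z\<bar>)\<^sup>2 * (\<delta> / 2 * h ^ CARD('d)))"
      using assms \<open>\<epsilon> > 0\<close> unfolding C_def by (simp add: power_mult_distrib)
    also have "\<dots> \<le> C * (LINT x:E|lebesgue. (p x)\<^sup>2)"
      using lower \<open>C \<ge> 0\<close> by (rule mult_left_mono)
    finally show ?thesis .
  qed
  ultimately show ?thesis by (intro exI[of _ C] conjI ballI allI impI)
qed

section \<open>The squared integrand of order \<open>m\<close>, treated uniformly in
  \<open>m\<close>\<close>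

definition grad_sq :: "nat \<Rightarrow> (real ^ 'd \<Rightarrow> real) \<Rightarrow> real ^ 'd \<Rightarrow> real" where
  "grad_sq m v x = (if m = 0 then (v x)\<^sup>2 else (norm (grad v x))\<^sup>2)"

lemma grad_sq_nonneg: "0 \<le> grad_sq m v x"
  by (simp add: grad_sq_def)

lemma norm_grad_power2: "(norm (grad v x))\<^sup>2 = (\<Sum>i\<in>UNIV. (grad v x $ i)\<^sup>2)"
  by (simp add: norm_vec_def L2_set_def sum_nonneg)

lemma l2_grad_norm_power2: "(l2_grad_norm m X v)\<^sup>2 = (LINT x:X|lebesgue. grad_sq m v x)"
  by (simp add: l2_grad_norm_def l2_norm_def grad_sq_def set_lebesgue_integral_def)

text \<open>The gradient is a pointwise derivative, so agreement of values must hold on a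
  neighbourhood; agreement on a closed element says nothing about gradients on its boundary.\<close>

lemma grad_sq_cong_open:
  assumes "w differentiable at x" "open U" "x \<in> U" "\<And>y. y \<in> U \<Longrightarrow> v y = w y"
  shows "grad_sq m v x = grad_sq m w x"
proof -
  have "frechet_derivative v (at x) = frechet_derivative w (at x)"
    using frechet_derivative_transform_within_open[of w x U v] assms by simp
  then show ?thesis using assms(3,4) by (simp add: grad_sq_def grad_def)
qed

lemma continuous_on_grad_sq:
  fixes p :: "real ^ 'd \<Rightarrow> real"
  assumes "p \<in> poly_space k"
  shows "continuous_on S (grad_sq m p)"
  unfolding grad_sq_def norm_grad_power2
  by (cases "m = 0") (auto intro!: continuous_intros continuous_on_poly_space[OF assms]
      continuous_on_poly_space[OF grad_poly_space[OF assms]])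

lemma set_integral_sum:
  fixes f :: "'i \<Rightarrow> 'a \<Rightarrow> real"
  assumes "\<And>i. i \<in> I \<Longrightarrow> set_integrable M A (f i)"
  shows "(LINT x:A|M. \<Sum>i\<in>I. f i x) = (\<Sum>i\<in>I. LINT x:A|M. f i x)"
  using assms unfolding set_lebesgue_integral_def set_integrable_def
  by (simp add: sum_distrib_left Bochner_Integration.integral_sum)

text \<open>For the gradient, the scalar comparison is applied to each partial derivative, again a
  polynomial of degree at most \<open>k\<close>. Summing over the components keeps the
  constant.\<close>

lemma poly_space_grad_comparison:
  fixes R \<delta> :: real
  assumes "\<delta> > 0" "R > 0"
  shows "\<exists>C\<ge>0. \<forall>p \<in> poly_space k. \<forall>a :: real ^ 'd. \<forall>h>0. \<forall>T E.
    T \<in> sets lebesgue \<longrightarrow> E \<in> sets lebesgue \<longrightarrow> T \<subseteq> cball a (R * h) \<longrightarrow> E \<subseteq> cball a (R * h) \<longrightarrow>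
    \<delta> * h ^ CARD('d) \<le> measure lebesgue E \<longrightarrow>
    (LINT x:T|lebesgue. grad_sq m p x) \<le> C * (LINT x:E|lebesgue. grad_sq m p x)"
proof -
  from poly_space_l2_comparison[where ?'d = 'd, OF assms, of k]
  obtain C where "C \<ge> 0" and C: "\<forall>p \<in> poly_space k. \<forall>a :: real ^ 'd. \<forall>h>0. \<forall>T E.
    T \<in> sets lebesgue \<longrightarrow> E \<in> sets lebesgue \<longrightarrow> T \<subseteq> cball a (R * h) \<longrightarrow> E \<subseteq> cball a (R * h) \<longrightarrow>
    \<delta> * h ^ CARD('d) \<le> measure lebesgue E \<longrightarrow>
    (LINT x:T|lebesgue. (p x)\<^sup>2) \<le> C * (LINT x:E|lebesgue. (p x)\<^sup>2)"
    by (elim exE conjE)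
  have "(LINT x:T|lebesgue. grad_sq m p x) \<le> C * (LINT x:E|lebesgue. grad_sq m p x)"
    if p: "p \<in> poly_space k" and h: "h > 0"
      and sets: "T \<in> sets lebesgue" "E \<in> sets lebesgue" "T \<subseteq> cball a (R * h)" "E \<subseteq> cball a (R * h)"
      and large: "\<delta> * h ^ CARD('d) \<le> measure lebesgue E"
    for p and a :: "real ^ 'd" and h T E
  proof (cases "m = 0")
    case True
    then show ?thesis using C[rule_format, OF p h sets large] by (simp add: grad_sq_def)
  next
    case False
    have g: "(\<lambda>x. grad p x $ i) \<in> poly_space k" for i
      using p by (rule grad_poly_space)
    have int: "set_integrable lebesgue S (\<lambda>x. (grad p x $ i)\<^sup>2)"
      if "S \<in> sets lebesgue" "S \<subseteq> cball a (R * h)" for S i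
      using that by (intro set_integrable_lebesgue_continuous[OF compact_cball]
          continuous_intros continuous_on_poly_space[OF g])
    have eq: "(LINT x:S|lebesgue. grad_sq m p x) = (\<Sum>i\<in>UNIV. LINT x:S|lebesgue. (grad p x $ i)\<^sup>2)"
      if "S \<in> sets lebesgue" "S \<subseteq> cball a (R * h)" for S
      using False set_integral_sum[of UNIV lebesgue S "\<lambda>i x. (grad p x $ i)\<^sup>2"] int[OF that]
      by (simp add: grad_sq_def norm_grad_power2)
    show ?thesis
      unfolding eq[OF sets(1,3)] eq[OF sets(2,4)] sum_distrib_left
      by (intro sum_mono C[rule_format, OF g h sets large])
  qed
  with \<open>C \<ge> 0\<close> show ?thesis by (intro exI[of _ C] conjI ballI allI impI)
qed

section \<open>Quasiuniform meshes\<close>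

context
  fixes \<rho> h :: real and \<Omega>0 :: "(real ^ 'd) set" and \<T> :: "(real ^ 'd) set set"
  assumes mesh: "quasiuniform_mesh \<rho> h \<Omega>0 \<T>"
begin

lemma mesh_finite: "finite \<T>"
  and mesh_simplex: "T \<in> \<T> \<Longrightarrow> int CARD('d) simplex T"
  and mesh_face: "T \<in> \<T> \<Longrightarrow> T' \<in> \<T> \<Longrightarrow> (T \<inter> T') face_of T"
  and mesh_Union: "\<Union>\<T> = \<Omega>0"
  and mesh_diameter: "T \<in> \<T> \<Longrightarrow> diameter T \<le> h"
  and mesh_cball: "T \<in> \<T> \<Longrightarrow> \<exists>x. cball x (\<rho> * h) \<subseteq> T"
  using mesh by (auto simp: quasiuniform_mesh_def simplicial_mesh_def triangulation_def)

lemma mesh_compact: "T \<in> \<T> \<Longrightarrow> compact T"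
  and mesh_convex: "T \<in> \<T> \<Longrightarrow> convex T"
  and mesh_aff_dim: "T \<in> \<T> \<Longrightarrow> aff_dim T = int CARD('d)"
  using mesh_simplex by (auto intro: polytope_imp_compact simplex_imp_polytope convex_simplex aff_dim_simplex)

lemma mesh_dist_le: "T \<in> \<T> \<Longrightarrow> x \<in> T \<Longrightarrow> y \<in> T \<Longrightarrow> dist x y \<le> h"
  using diameter_bounded_bound[of T x y] mesh_compact[of T] mesh_diameter[of T]
  by (simp add: compact_imp_bounded)

text \<open>The intersection is a face of both elements and, as they differ, a proper face of at
  least one. It therefore has lower dimension, and a convex set with empty interior is null.\<close>

lemma mesh_negligible_Int:
  assumes "T \<in> \<T>" "T' \<in> \<T>" "T \<noteq> T'"
  shows "negligible (T \<inter> T')"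
proof -
  have *: "negligible (T \<inter> T')" if "T \<in> \<T>" "T' \<in> \<T>" "T \<inter> T' \<noteq> T" for T T'
  proof -
    have "aff_dim (T \<inter> T') < aff_dim T"
      using that by (intro face_of_aff_dim_lt mesh_convex mesh_face)
    then have "interior (T \<inter> T') = {}"
      using mesh_aff_dim[OF that(1)] by (intro low_dim_interior) simp
    then show ?thesis
      using that by (simp add: negligible_convex_interior convex_Int mesh_convex)
  qed
  show ?thesis
    using *[of T T'] *[of T' T] assms by (cases "T \<inter> T' = T") (auto simp: Int_commute)
qed

lemma mesh_disjoint_interior:
  assumes "T \<in> \<T>" "T' \<in> \<T>" "T \<noteq> T'"
  shows "interior T \<inter> interior T' = {}"
proof (rule ccontr)
  assume "interior T \<inter> interior T' \<noteq> {}"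
  then have "\<not> negligible (interior T \<inter> interior T')"
    by (intro open_not_negligible open_Int) auto
  moreover have "interior T \<inter> interior T' \<subseteq> T \<inter> T'" using interior_subset by blast
  ultimately show False
    using mesh_negligible_Int[OF assms] negligible_subset by blast
qed

text \<open>Neighbours share a facet, which is nonempty by definition, so a walk through common
  points costs at most one diameter per element.\<close>

lemma mesh_path_dist_le:
  assumes "h > 0"
  shows "successively face_neighbors Ts \<Longrightarrow> set Ts \<subseteq> \<T> \<Longrightarrow> Ts \<noteq> [] \<Longrightarrow>
    x \<in> hd Ts \<Longrightarrow> y \<in> last Ts \<Longrightarrow> dist x y \<le> length Ts * h"
proof (induction Ts arbitrary: x)
  case (Cons T Ts)
  show ?case
  proof (cases "Ts = []")
    case True
    then show ?thesis using Cons.prems mesh_dist_le[of T x y] by simp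
  next
    case False
    then have "face_neighbors T (hd Ts)" using Cons.prems by (simp add: successively_Cons)
    then obtain z where z: "z \<in> T" "z \<in> hd Ts"
      unfolding face_neighbors_def facet_of_def by blast
    have "dist x z \<le> h" using mesh_dist_le[of T x z] Cons.prems z by simp
    moreover have "dist z y \<le> length Ts * h"
      using Cons.IH[OF _ _ False z(2)] Cons.prems False by (simp add: successively_Cons)
    ultimately show ?thesis using dist_triangle[of x y z] by (simp add: algebra_simps)
  qed
qed simp

section \<open>Volumes and numbers of elements\<close>

lemma mesh_measure_ge:
  assumes "T \<in> \<T>" "\<rho> > 0" "h > 0"
  shows "measure lebesgue (cball (0 :: real ^ 'd) 1) * (\<rho> * h) ^ CARD('d) \<le> measure lebesgue T"
proof -
  obtain x where x: "cball x (\<rho> * h) \<subseteq> T" using mesh_cball[OF assms(1)] by blast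
  have "measure lebesgue (cball x (\<rho> * h)) \<le> measure lebesgue T"
    using x lmeasurable_compact[OF mesh_compact[OF assms(1)]] by (intro measure_mono_fmeasurable) auto
  then show ?thesis
    using assms content_ball_conv_unit_ball[of "\<rho> * h" x] by (simp add: content_cball_conv_ball mult.commute)
qed

lemma mesh_not_negligible:
  assumes "T \<in> \<T>" "\<rho> > 0" "h > 0"
  shows "\<not> negligible T"
proof
  assume "negligible T"
  then have "measure lebesgue (cball (0 :: real ^ 'd) 1) * (\<rho> * h) ^ CARD('d) \<le> 0"
    using mesh_measure_ge[OF assms] by (simp add: negligible_imp_measure0)
  moreover have "0 < measure lebesgue (cball (0 :: real ^ 'd) 1) * (\<rho> * h) ^ CARD('d)"
    using assms content_cball_pos[of 1 "0 :: real ^ 'd"] by simp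
  ultimately show False by simp
qed

text \<open>A packing argument: elements overlap only in null sets and each has at least the volume
  of its inscribed ball, so the volume of the large ball limits their number.\<close>

lemma mesh_card_in_cball:
  assumes "\<rho> > 0" "h > 0" "R > 0"
  shows "card {T\<in>\<T>. T \<subseteq> cball a (R * h)} \<le> (R / \<rho>) ^ CARD('d)"
proof -
  let ?F = "{T\<in>\<T>. T \<subseteq> cball a (R * h)}" and ?V = "measure lebesgue (cball (0 :: real ^ 'd) 1)"
  have "?V > 0" using content_cball_pos[of 1 "0 :: real ^ 'd"] by simp
  have F: "finite ?F" "T \<in> ?F \<Longrightarrow> T \<in> lmeasurable" for T
    using mesh_finite mesh_compact lmeasurable_compact by auto
  have "card ?F * (?V * (\<rho> * h) ^ CARD('d)) \<le> (\<Sum>T\<in>?F. measure lebesgue T)"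
    using sum_bounded_below[of ?F "?V * (\<rho> * h) ^ CARD('d)" "measure lebesgue"] mesh_measure_ge assms
    by simp
  also have "\<dots> = measure lebesgue (\<Union>?F)"
    by (intro measure_negligible_finite_Union[symmetric] F)
      (auto simp: pairwise_def mesh_negligible_Int)
  also have "\<dots> \<le> measure lebesgue (cball a (R * h))"
    using F by (intro measure_mono_fmeasurable) (auto intro!: fmeasurableD)
  also have "\<dots> = ?V * (R * h) ^ CARD('d)"
    using assms content_ball_conv_unit_ball[of "R * h" a] by (simp add: content_cball_conv_ball mult.commute)
  finally show ?thesis
    using \<open>?V > 0\<close> assms by (simp add: power_mult_distrib power_divide field_simps)
qed

section \<open>Finite element functions on the active mesh\<close>

lemma active_fe_space_poly:
  assumes "v \<in> active_fe_space k \<Omega>0 \<Omega> \<T>" and T: "T \<in> active_mesh \<Omega> \<T>"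
    and "\<rho> > 0" "h > 0"
  shows "canonical_ext k v T \<in> poly_space k" and "x \<in> T \<Longrightarrow> v x = canonical_ext k v T x"
proof -
  obtain w where w: "w \<in> fe_space k \<Omega>0 \<T>" "v = restrict w (\<Union>(active_mesh \<Omega> \<T>))"
    using assms(1) unfolding active_fe_space_def by blast
  have "T \<in> \<T>" using T by (simp add: active_mesh_def)
  then obtain p where p: "p \<in> poly_space k" "\<And>x. x \<in> T \<Longrightarrow> w x = p x"
    using w(1) unfolding fe_space_def by blast
  have vp: "v x = p x" if "x \<in> T" for x
    using p(2)[OF that] that T by (auto simp: w(2))
  then have "canonical_ext k v T = p"
    using mesh_not_negligible[OF \<open>T \<in> \<T>\<close> assms(3,4)] by (intro canonical_ext_eqI p(1))
  with p(1) vp[of x] show "canonical_ext k v T \<in> poly_space k" and "x \<in> T \<Longrightarrow> v x = canonical_ext k v T x"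
    by simp_all
qed

text \<open>On the interior of an element \<open>v\<close> has the gradient of its polynomial, on the boundary it need not.\<close>
lemma active_fe_space_integral:
  assumes v: "v \<in> active_fe_space k \<Omega>0 \<Omega> \<T>" and T: "T \<in> active_mesh \<Omega> \<T>"
    and \<Omega>: "closed \<Omega>" and "\<rho> > 0" "h > 0"
  shows "set_integrable lebesgue (interior T \<inter> \<Omega>) (grad_sq m v)"
    and "(LINT x:T \<inter> \<Omega>|lebesgue. grad_sq m (canonical_ext k v T) x)
      = (LINT x:interior T \<inter> \<Omega>|lebesgue. grad_sq m v x)"
proof -
  let ?p = "canonical_ext k v T"
  have p: "?p \<in> poly_space k" and vp: "\<And>x. x \<in> T \<Longrightarrow> v x = ?p x"
    using active_fe_space_poly[OF v T assms(4,5)] by blast+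
  have "T \<in> \<T>" using T by (simp add: active_mesh_def)
  note cT = mesh_compact[OF \<open>T \<in> \<T>\<close>]
  have sets: "T \<inter> \<Omega> \<in> sets lebesgue" "interior T \<inter> \<Omega> \<in> sets lebesgue"
    using compact_imp_closed[OF cT] \<Omega> by (simp_all add: sets.Int borel_closed borel_open)
  have int: "set_integrable lebesgue S (grad_sq m ?p)" if "S \<in> sets lebesgue" "S \<subseteq> T" for S
    using that by (intro set_integrable_lebesgue_continuous[OF cT] continuous_on_grad_sq[OF p])
  have eq: "grad_sq m v x = grad_sq m ?p x" if "x \<in> interior T \<inter> \<Omega>" for x
    using that vp interior_subset[of T]
    by (intro grad_sq_cong_open[OF poly_space_differentiable[OF p] open_interior[of T]]) auto
  have "interior T \<inter> \<Omega> \<subseteq> T" using interior_subset by blast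
  note int' = int[OF sets(2) this]
  then show "set_integrable lebesgue (interior T \<inter> \<Omega>) (grad_sq m v)"
    using eq by (subst set_integrable_cong[OF refl refl]) auto
  \<comment> \<open>In terms of the gauge integral the boundary of \<open>T\<close> can be discarded
    as the null frontier of a convex set. Only then is the polynomial exchanged for
    \<open>v\<close>.\<close>
  have "(LINT x:T \<inter> \<Omega>|lebesgue. grad_sq m ?p x) = integral (T \<inter> \<Omega>) (grad_sq m ?p)"
    using int[OF sets(1)] by (intro set_lebesgue_integral_eq_integral) auto
  also have "\<dots> = integral (interior T \<inter> \<Omega>) (grad_sq m ?p)"
  proof (rule integral_spike_set)
    have "negligible (frontier T)"
      using mesh_convex[OF \<open>T \<in> \<T>\<close>] by (rule negligible_convex_frontier)
    then show "negligible {x \<in> T \<inter> \<Omega> - interior T \<inter> \<Omega>. grad_sq m ?p x \<noteq> 0}"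
      by (rule negligible_subset) (use closure_subset in \<open>auto simp: frontier_def\<close>)
    have "{x \<in> interior T \<inter> \<Omega> - T \<inter> \<Omega>. grad_sq m ?p x \<noteq> 0} = {}"
      using interior_subset by blast
    then show "negligible {x \<in> interior T \<inter> \<Omega> - T \<inter> \<Omega>. grad_sq m ?p x \<noteq> 0}"
      by (simp only: negligible_empty)
  qed
  also have "\<dots> = (LINT x:interior T \<inter> \<Omega>|lebesgue. grad_sq m ?p x)"
    using set_lebesgue_integral_eq_integral(2)[OF int'] by simp
  also have "\<dots> = (LINT x:interior T \<inter> \<Omega>|lebesgue. grad_sq m v x)"
    using sets eq by (intro set_lebesgue_integral_cong) auto
  finally show "(LINT x:T \<inter> \<Omega>|lebesgue. grad_sq m ?p x)
      = (LINT x:interior T \<inter> \<Omega>|lebesgue. grad_sq m v x)" .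
qed

text \<open>A point of \<Omega> lies in some element, which is thereby active. Hence the disjoint
  interiors of active elements cover \<Omega> up to element boundaries, a null set on which the
  pointwise gradient of \<open>v\<close> is immaterial.\<close>

lemma active_fe_space_sum_integral:
  assumes v: "v \<in> active_fe_space k \<Omega>0 \<Omega> \<T>" and \<Omega>: "closed \<Omega>" "\<Omega> \<subseteq> \<Omega>0" and "\<rho> > 0" "h > 0"
  shows "(\<Sum>T\<in>active_mesh \<Omega> \<T>. LINT x:interior T \<inter> \<Omega>|lebesgue. grad_sq m v x)
    = (LINT x:\<Omega>|lebesgue. grad_sq m v x)"
proof -
  let ?A = "active_mesh \<Omega> \<T>"
  have A: "?A \<subseteq> \<T>" "finite ?A" using mesh_finite by (auto simp: active_mesh_def)
  define U where "U = (\<Union>T\<in>?A. interior T \<inter> \<Omega>)"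
  have sets: "interior T \<inter> \<Omega> \<in> sets lebesgue" for T
    using \<Omega>(1) by (auto intro!: sets.Int sets_completionI_sets borel_closed borel_open)
  note int = active_fe_space_integral(1)[OF v _ \<Omega>(1) assms(4,5), of _ m]
  have U_int: "set_integrable lebesgue U (grad_sq m v)"
    unfolding U_def using A sets int by (intro set_integrable_UN) auto
  have "negligible (\<Union>T\<in>?A. frontier T)"
    using A mesh_convex by (intro negligible_Union) (auto intro!: negligible_convex_frontier)
  moreover have "\<Omega> - U \<subseteq> (\<Union>T\<in>?A. frontier T)"
  proof
    fix x assume x: "x \<in> \<Omega> - U"
    then obtain T where "T \<in> \<T>" "x \<in> T" using \<Omega>(2) mesh_Union by blast
    then have "T \<in> ?A" using x by (auto simp: active_mesh_def)
    then have "x \<notin> interior T" using x by (auto simp: U_def)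
    then show "x \<in> (\<Union>T\<in>?A. frontier T)"
      using \<open>T \<in> ?A\<close> \<open>x \<in> T\<close> closure_subset by (auto simp: frontier_def)
  qed
  ultimately have null: "negligible {x \<in> \<Omega> - U. grad_sq m v x \<noteq> 0}"
    by (rule negligible_subset[OF negligible_subset]) auto
  have "{x \<in> U - \<Omega>. grad_sq m v x \<noteq> 0} = {}" by (auto simp: U_def)
  then have null': "negligible {x \<in> U - \<Omega>. grad_sq m v x \<noteq> 0}" by (simp only: negligible_empty)
  \<comment> \<open>Integrability is inherited from the union of the cut interiors, where
    \<open>v\<close> is locally polynomial, since \<open>U\<close> and \<Omega> differ by a null
    set.\<close>
  have \<Omega>_int: "set_integrable lebesgue \<Omega> (grad_sq m v)"
    using U_int absolutely_integrable_spike_set_eq[OF null' null] by simp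
  have "(\<Sum>T\<in>?A. LINT x:interior T \<inter> \<Omega>|lebesgue. grad_sq m v x) = (LINT x:U|lebesgue. grad_sq m v x)"
    unfolding U_def
  proof (rule set_integral_finite_Union[symmetric])
    show "disjoint_family_on (\<lambda>T. interior T \<inter> \<Omega>) ?A"
      using mesh_disjoint_interior A(1) unfolding disjoint_family_on_def by blast
  qed (use A sets int in auto)
  also have "\<dots> = (LINT x:\<Omega>|lebesgue. grad_sq m v x)"
    using integral_spike_set[OF null' null] set_lebesgue_integral_eq_integral(2)[OF U_int]
      set_lebesgue_integral_eq_integral(2)[OF \<Omega>_int] by simp
  finally show ?thesis .
qed

end

section \<open>Stabilization\<close>

lemma sym_psd_form_combination:
  fixes s t :: real
  assumes b: "sym_psd_form k b" and p: "p \<in> poly_space k" and q: "q \<in> poly_space k"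
  defines "r \<equiv> \<lambda>x. s * p x + t * q x"
  shows "b r r = s\<^sup>2 * b p p + 2 * s * t * b p q + t\<^sup>2 * b q q"
proof -
  have sym: "b p q = b q p" if "p \<in> poly_space k" "q \<in> poly_space k" for p q
    using b that by (simp add: sym_psd_form_def)
  have lin: "b r u = s * b p u + t * b q u" if "u \<in> poly_space k" for u
    using b p q that unfolding sym_psd_form_def r_def by blast
  have r: "r \<in> poly_space k" unfolding r_def using p q by (rule poly_space_linear_combination)
  \<comment> \<open>The definition gives linearity in the first argument only; symmetry carries it
    to the second.\<close>
  have "b r r = s * b r p + t * b r q"
    using lin[OF r] sym[OF p r] sym[OF q r] by simp
  also have "\<dots> = s * (s * b p p + t * b q p) + t * (s * b p q + t * b q q)"
    using lin[OF p] lin[OF q] by simp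
  finally show ?thesis using sym[OF p q] by (simp add: power2_eq_square algebra_simps)
qed

lemma form_norm_power2:
  assumes "sym_psd_form k b" "p \<in> poly_space k"
  shows "(form_norm b p)\<^sup>2 = b p p"
  using assms by (simp add: form_norm_def sym_psd_form_def)

text \<open>The right side minus the left side is exactly the form evaluated at p - 2 * q, the term
  dropped from the parallelogram identity for p - q and q.\<close>

lemma form_norm_le_jump:
  assumes b: "sym_psd_form k b" and p: "p \<in> poly_space k" and q: "q \<in> poly_space k"
  shows "(form_norm b p)\<^sup>2 \<le> 2 * b (\<lambda>x. p x - q x) (\<lambda>x. p x - q x) + 2 * (form_norm b q)\<^sup>2"
proof -
  have "(\<lambda>x. 1 * p x + (-2) * q x) \<in> poly_space k"
    using p q by (rule poly_space_linear_combination)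
  then have "0 \<le> b (\<lambda>x. 1 * p x + (-2) * q x) (\<lambda>x. 1 * p x + (-2) * q x)"
    using b unfolding sym_psd_form_def by blast
  then have "0 \<le> b p p - 4 * b p q + 4 * b q q"
    using sym_psd_form_combination[OF b p q, of 1 "-2"] by simp
  moreover have "b (\<lambda>x. p x - q x) (\<lambda>x. p x - q x) = b p p - 2 * b p q + b q q"
    using sym_psd_form_combination[OF b p q, of 1 "-1"] by simp
  ultimately show ?thesis by (simp add: form_norm_power2[OF b p] form_norm_power2[OF b q])
qed

lemma stab_triples_finite:
  assumes "stab_triples k \<gamma> \<Omega> \<T> Sh \<S>" "multiplicity_le M \<S>" "finite \<T>"
  shows "finite \<S>"
proof (rule finite_subset)
  show "\<S> \<subseteq> (\<Union>T\<in>\<T>. {(b, T1, T2) \<in> \<S>. T1 = T})"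
    using assms(1) by (fastforce simp: stab_triples_def small_elements_def active_mesh_def)
  show "finite (\<Union>T\<in>\<T>. {(b, T1, T2) \<in> \<S>. T1 = T})"
    using assms(2,3) by (auto simp: multiplicity_le_def)
qed

lemma closed_domain_closed: "closed_domain \<Omega> \<Longrightarrow> closed \<Omega>"
  by (auto simp: closed_domain_def)

text \<open>The triples are grouped by their third component T'. Those sharing T' start in elements
  inside one ball, whose number is bounded by packing, and each of these elements carries at most
  \<open>M\<close> triples.\<close>

lemma sum_stab_triples_le:
  fixes \<Omega>0 :: "(real ^ 'd) set" and \<S> :: "(real ^ 'd) stab_triple set"
  assumes mesh: "quasiuniform_mesh \<rho> h \<Omega>0 \<T>" and pos: "0 < \<rho>" "0 < h" "0 < R"
    and fin: "finite \<S>" and mult: "multiplicity_le M \<S>"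
    and in_mesh: "\<And>b T T'. (b, T, T') \<in> \<S> \<Longrightarrow> T \<in> \<T> \<and> T' \<in> A \<and> T \<subseteq> cball (c T') (R * h)"
    and A: "finite A" and g: "\<And>T. T \<in> A \<Longrightarrow> 0 \<le> g T"
  shows "(\<Sum>(b, T, T')\<in>\<S>. g T') \<le> real M * (R / \<rho>) ^ CARD('d) * (\<Sum>T\<in>A. g T)"
proof -
  have card: "card {(b, T1, T2) \<in> \<S>. T2 = T'} \<le> real M * (R / \<rho>) ^ CARD('d)" for T'
  proof -
    let ?F = "{T\<in>\<T>. T \<subseteq> cball (c T') (R * h)}"
    have F: "finite ?F" using mesh_finite[OF mesh] by simp
    have fin': "finite {(b, T1, T2) \<in> \<S>. T1 = T}" and M: "card {(b, T1, T2) \<in> \<S>. T1 = T} \<le> M" for T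
      using mult by (auto simp: multiplicity_le_def)
    have "{(b, T1, T2) \<in> \<S>. T2 = T'} \<subseteq> (\<Union>T\<in>?F. {(b, T1, T2) \<in> \<S>. T1 = T})"
      using in_mesh by fastforce
    then have "card {(b, T1, T2) \<in> \<S>. T2 = T'} \<le> card (\<Union>T\<in>?F. {(b, T1, T2) \<in> \<S>. T1 = T})"
      using F fin' by (intro card_mono) auto
    also have "\<dots> \<le> (\<Sum>T\<in>?F. card {(b, T1, T2) \<in> \<S>. T1 = T})"
      by (rule card_UN_le[OF F])
    also have "\<dots> \<le> (\<Sum>T\<in>?F. M)" by (intro sum_mono M)
    finally have "card {(b, T1, T2) \<in> \<S>. T2 = T'} \<le> card ?F * M" by simp
    then have "real (card {(b, T1, T2) \<in> \<S>. T2 = T'}) \<le> real M * card ?F"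
      unfolding of_nat_mult[symmetric] of_nat_le_iff by (simp only: mult.commute)
    also have "\<dots> \<le> real M * (R / \<rho>) ^ CARD('d)"
      by (intro mult_left_mono mesh_card_in_cball[OF mesh pos]) auto
    finally show ?thesis .
  qed
  have "(\<Sum>(b, T, T')\<in>\<S>. g T') = (\<Sum>s\<in>\<S>. g (snd (snd s)))"
    by (intro sum.cong) auto
  also have "\<dots> = (\<Sum>T'\<in>A. \<Sum>s\<in>{s\<in>\<S>. snd (snd s) = T'}. g (snd (snd s)))"
    using in_mesh by (intro sum.group[symmetric] fin A) fastforce
  also have "\<dots> = (\<Sum>T'\<in>A. card {(b, T1, T2) \<in> \<S>. T2 = T'} * g T')"
  proof (intro sum.cong refl)
    fix T'
    have "{s\<in>\<S>. snd (snd s) = T'} = {(b, T1, T2) \<in> \<S>. T2 = T'}" by auto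
    moreover have "(\<Sum>s\<in>{s\<in>\<S>. snd (snd s) = T'}. g (snd (snd s))) = (\<Sum>s\<in>{s\<in>\<S>. snd (snd s) = T'}. g T')"
      by (intro sum.cong) auto
    ultimately show "(\<Sum>s\<in>{s\<in>\<S>. snd (snd s) = T'}. g (snd (snd s)))
        = card {(b, T1, T2) \<in> \<S>. T2 = T'} * g T'" by simp
  qed
  also have "\<dots> \<le> (\<Sum>T'\<in>A. real M * (R / \<rho>) ^ CARD('d) * g T')"
    by (intro sum_mono mult_right_mono card g)
  finally show ?thesis by (simp add: sum_distrib_left)
qed

section \<open>Assembly of the estimate\<close>

theorem lemma3p1:
  fixes \<Omega>0 :: "(real ^ 'd) set"
    and k m M N :: nat
    and h0 \<rho> \<gamma> \<tau> \<alpha> C1 :: real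
  assumes "polygonal_domain \<Omega>0"
    and "0 < h0" and "0 < \<rho>" and "0 < \<gamma>" and "\<gamma> \<le> 1" and "0 < \<tau>"
    and "m \<in> {0, 1}"
  shows "\<exists>C::real. \<forall>h \<T> \<Omega> Sh (\<S> :: (real ^ 'd) stab_triple set).
    0 < h \<longrightarrow> h \<le> h0 \<longrightarrow>
    quasiuniform_mesh \<rho> h \<Omega>0 \<T> \<longrightarrow>
    closed_domain \<Omega> \<longrightarrow> \<Omega> \<subseteq> \<Omega>0 \<longrightarrow>
    Sh \<in> small_elements \<gamma> \<Omega> \<T> \<rightarrow> large_elements \<gamma> \<Omega> \<T> \<longrightarrow>
    stab_triples k \<gamma> \<Omega> \<T> Sh \<S> \<longrightarrow> multiplicity_le M \<S> \<longrightarrow>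
    assumption_A1 k m \<alpha> C1 h \<S> \<longrightarrow>
    assumption_A2 N \<Omega> \<T> \<S> \<longrightarrow>
    (\<forall>v \<in> active_fe_space k \<Omega>0 \<Omega> \<T>.
      (\<Sum>(b, T, T') \<in> \<S>. h powr \<alpha> * (form_norm b (canonical_ext k v T))\<^sup>2)
        \<le> C * ((l2_grad_norm m \<Omega> v)\<^sup>2 + (stab_norm k \<tau> \<alpha> h \<S> v)\<^sup>2))"
proof -
  define V where "V = measure lebesgue (cball (0 :: real ^ 'd) 1)"
  have "V > 0" using content_cball_pos[of 1 "0 :: real ^ 'd"] by (simp add: V_def)
  \<comment> \<open>A large element contains a ball of radius \<rho> * h and meets \<Omega> in at
    least the fraction \<gamma> of its volume; \<delta> is the resulting lower bound after scaling
    to \<open>h = 1\<close>.\<close>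
  define \<delta> where "\<delta> = \<gamma> * (V * \<rho> ^ CARD('d))"
  have "\<delta> > 0" using assms \<open>V > 0\<close> by (simp add: \<delta>_def)
  \<comment> \<open>A path of at most \<open>N\<close> elements stays within distance N * h of any
    point of its last element. The added 1 makes the ball contain that last element too, whatever
    \<open>N\<close> is.\<close>
  define R where "R = real N + 1"
  have "R > 0" by (simp add: R_def)
  from poly_space_grad_comparison[where ?'d = 'd, OF \<open>\<delta> > 0\<close> \<open>R > 0\<close>, of k m]
  obtain C0 where "C0 \<ge> 0" and C0: "\<forall>p \<in> poly_space k. \<forall>a :: real ^ 'd. \<forall>h>0. \<forall>T E.
    T \<in> sets lebesgue \<longrightarrow> E \<in> sets lebesgue \<longrightarrow> T \<subseteq> cball a (R * h) \<longrightarrow> E \<subseteq> cball a (R * h) \<longrightarrow>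
    \<delta> * h ^ CARD('d) \<le> measure lebesgue E \<longrightarrow>
    (LINT x:T|lebesgue. grad_sq m p x) \<le> C0 * (LINT x:E|lebesgue. grad_sq m p x)"
    by (elim exE conjE)
  define K where "K = real M * (R / \<rho>) ^ CARD('d)"
  have "K \<ge> 0" using assms \<open>R > 0\<close> by (simp add: K_def)
  \<comment> \<open>The factors are the 2 from splitting off the jump, the constants of A1 and of
    the polynomial comparison, and the overlap bound. The absolute value is taken because
    \<open>C1\<close> may be negative.\<close>
  define D where "D = 2 * (\<bar>C1\<bar> * C0) * K"
  have "D \<ge> 0" using \<open>C0 \<ge> 0\<close> \<open>K \<ge> 0\<close> by (simp add: D_def)
  show ?thesis
  proof (intro exI[of _ "2 / \<tau> + D"] allI impI ballI)
    fix h \<T> \<Omega> Sh v and \<S> :: "(real ^ 'd) stab_triple set"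
    assume h: "0 < h" "h \<le> h0" and mesh: "quasiuniform_mesh \<rho> h \<Omega>0 \<T>"
      and \<Omega>: "closed_domain \<Omega>" "\<Omega> \<subseteq> \<Omega>0"
      and Sh: "Sh \<in> small_elements \<gamma> \<Omega> \<T> \<rightarrow> large_elements \<gamma> \<Omega> \<T>"
      and S: "stab_triples k \<gamma> \<Omega> \<T> Sh \<S>" and M: "multiplicity_le M \<S>"
      and A1: "assumption_A1 k m \<alpha> C1 h \<S>" and A2: "assumption_A2 N \<Omega> \<T> \<S>"
      and v: "v \<in> active_fe_space k \<Omega>0 \<Omega> \<T>"
    let ?A = "active_mesh \<Omega> \<T>" and ?p = "canonical_ext k v"
    define I where "I = (\<lambda>T. LINT x:interior T \<inter> \<Omega>|lebesgue. grad_sq m v x)"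
    define J :: "(real ^ 'd) stab_triple \<Rightarrow> real" where "J = (\<lambda>(b, T, T'). b (jump k v T T') (jump k v T T'))"
    have "closed \<Omega>" using \<Omega>(1) by (rule closed_domain_closed)
    have A: "finite ?A" "?A \<subseteq> \<T>" using mesh_finite[OF mesh] by (auto simp: active_mesh_def)
    \<comment> \<open>Over an infinite index set the sums would be 0 by convention.\<close>
    have finS: "finite \<S>" using stab_triples_finite[OF S M mesh_finite[OF mesh]] .
    have I_nonneg: "0 \<le> I T" for T
      unfolding I_def set_lebesgue_integral_def by (intro integral_nonneg_AE AE_I2) (simp add: grad_sq_nonneg)
    have p: "?p T \<in> poly_space k" if "T \<in> ?A" for T
      using active_fe_space_poly(1)[OF mesh v that assms(3) h(1)] .
    \<comment> \<open>The centre of a ball inscribed in T' will be the centre of the ball containing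
      both T and T'.\<close>
    have "\<forall>T\<in>\<T>. \<exists>x. cball x (\<rho> * h) \<subseteq> T" using mesh_cball[OF mesh] by blast
    then obtain c where c: "\<And>T. T \<in> \<T> \<Longrightarrow> cball (c T) (\<rho> * h) \<subseteq> T" by metis
    have triple: "sym_psd_form k b \<and> T \<in> ?A \<and> T' \<in> ?A
        \<and> \<gamma> * measure lebesgue T' \<le> measure lebesgue (T' \<inter> \<Omega>)"
      and near: "T \<subseteq> cball (c T') (R * h)" "T' \<subseteq> cball (c T') (R * h)"
      if s: "(b, T, T') \<in> \<S>" for b T T'
    proof -
      have "sym_psd_form k b" "T \<in> small_elements \<gamma> \<Omega> \<T>" "T' = Sh T"
        using S that by (auto simp: stab_triples_def)
      moreover from this have "T' \<in> large_elements \<gamma> \<Omega> \<T>" using Sh by auto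
      ultimately show *: "sym_psd_form k b \<and> T \<in> ?A \<and> T' \<in> ?A
          \<and> \<gamma> * measure lebesgue T' \<le> measure lebesgue (T' \<inter> \<Omega>)"
        by (auto simp: small_elements_def large_elements_def)
      then have "T' \<in> \<T>" using A by blast
      moreover have "c T' \<in> cball (c T') (\<rho> * h)" using assms(3) h(1) by simp
      ultimately have "c T' \<in> T'" using c by blast
      obtain Ts where Ts: "Ts \<noteq> []" "length Ts \<le> N" "set Ts \<subseteq> ?A" "hd Ts = T" "last Ts = T'"
        "successively face_neighbors Ts"
        using bspec[OF A2[unfolded assumption_A2_def] s] by auto
      show "T \<subseteq> cball (c T') (R * h)"
      proof
        fix x assume "x \<in> T"
        then have "dist x (c T') \<le> length Ts * h"
          using Ts A \<open>c T' \<in> T'\<close> by (intro mesh_path_dist_le[OF mesh h(1)]) auto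
        also have "\<dots> \<le> R * h" using Ts h by (intro mult_right_mono) (auto simp: R_def)
        finally show "x \<in> cball (c T') (R * h)" by (simp add: dist_commute)
      qed
      show "T' \<subseteq> cball (c T') (R * h)"
      proof
        fix x assume "x \<in> T'"
        then have "dist (c T') x \<le> 1 * h"
          using mesh_dist_le[OF mesh, of T' "c T'" x] \<open>c T' \<in> T'\<close> * A by auto
        also have "\<dots> \<le> R * h" using h by (intro mult_right_mono) (auto simp: R_def)
        finally show "x \<in> cball (c T') (R * h)" by simp
      qed
    qed
    \<comment> \<open>A1 bounds the form at the extension from T' by an integral over T, and the
      comparison then moves this integral to the cut large element. There the polynomial is
      \<open>v\<close> itself, up to the boundary.\<close>
    have large: "h powr \<alpha> * (form_norm b (?p T'))\<^sup>2 \<le> \<bar>C1\<bar> * C0 * I T'" if s: "(b, T, T') \<in> \<S>" for b T T'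
    proof -
      note t = triple[OF s]
      have TT': "T \<in> \<T>" "T' \<in> \<T>" using t A by auto
      have meas: "T \<in> sets lebesgue" "T' \<inter> \<Omega> \<in> sets lebesgue"
        using mesh_compact[OF mesh TT'(1)] mesh_compact[OF mesh TT'(2)] \<open>closed \<Omega>\<close>
        by (simp_all add: borel_closed compact_imp_closed sets.Int)
      have "\<delta> * h ^ CARD('d) \<le> \<gamma> * measure lebesgue T'"
        using mesh_measure_ge[OF mesh TT'(2) assms(3) h(1)] assms(4)
        by (simp add: \<delta>_def V_def power_mult_distrib mult.assoc)
      then have ge: "\<delta> * h ^ CARD('d) \<le> measure lebesgue (T' \<inter> \<Omega>)" using t by simp
      have "h powr \<alpha> * (form_norm b (?p T'))\<^sup>2 \<le> C1 * (l2_grad_norm m T (?p T'))\<^sup>2"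
        using A1 s p t unfolding assumption_A1_def by blast
      also have "\<dots> \<le> \<bar>C1\<bar> * (l2_grad_norm m T (?p T'))\<^sup>2" by (intro mult_right_mono) auto
      also have "\<dots> = \<bar>C1\<bar> * (LINT x:T|lebesgue. grad_sq m (?p T') x)"
        by (simp add: l2_grad_norm_power2)
      also have "\<dots> \<le> \<bar>C1\<bar> * (C0 * (LINT x:T' \<inter> \<Omega>|lebesgue. grad_sq m (?p T') x))"
        using near[OF s] t p meas ge h by (intro mult_left_mono C0[rule_format, where a = "c T'" and h = h]) auto
      also have "\<dots> = \<bar>C1\<bar> * C0 * I T'"
        using active_fe_space_integral(2)[OF mesh v _ \<open>closed \<Omega>\<close> assms(3) h(1)] t by (simp add: I_def)
      finally show ?thesis .
    qed
    have J_nonneg: "0 \<le> J s" if "s \<in> \<S>" for s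
    proof -
      obtain b T T' where s: "s = (b, T, T')" by (cases s)
      have "jump k v T T' \<in> poly_space k"
        unfolding jump_def using triple that s p by (intro poly_space_diff) auto
      then show ?thesis
        using triple[of b T T'] that s by (simp add: J_def sym_psd_form_def)
    qed
    have stab: "\<tau> * h powr \<alpha> * (\<Sum>s\<in>\<S>. J s) = (stab_norm k \<tau> \<alpha> h \<S> v)\<^sup>2"
    proof -
      have eq: "stab_form k \<tau> \<alpha> h \<S> v v = \<tau> * h powr \<alpha> * (\<Sum>s\<in>\<S>. J s)"
        unfolding stab_form_def sum_distrib_left by (intro sum.cong) (auto simp: J_def)
      \<comment> \<open>The sign is needed for the square to undo the square root in
        \<open>stab_norm\<close>.\<close>
      have "0 \<le> \<tau> * h powr \<alpha> * (\<Sum>s\<in>\<S>. J s)"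
        using assms J_nonneg by (intro mult_nonneg_nonneg sum_nonneg) auto
      then show ?thesis by (simp add: stab_norm_def eq)
    qed
    have "(\<Sum>(b, T, T')\<in>\<S>. h powr \<alpha> * (form_norm b (?p T))\<^sup>2)
        \<le> (\<Sum>(b, T, T')\<in>\<S>. 2 * h powr \<alpha> * J (b, T, T') + 2 * (\<bar>C1\<bar> * C0) * I T')"
    proof (intro sum_mono, clarsimp)
      fix b T T' assume s: "(b, T, T') \<in> \<S>"
      have "(form_norm b (?p T))\<^sup>2 \<le> 2 * J (b, T, T') + 2 * (form_norm b (?p T'))\<^sup>2"
        using form_norm_le_jump[of k b "?p T" "?p T'"] triple[OF s] p by (simp add: J_def jump_def)
      then have "h powr \<alpha> * (form_norm b (?p T))\<^sup>2
          \<le> h powr \<alpha> * (2 * J (b, T, T') + 2 * (form_norm b (?p T'))\<^sup>2)"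
        by (intro mult_left_mono) auto
      then show "h powr \<alpha> * (form_norm b (?p T))\<^sup>2 \<le> 2 * h powr \<alpha> * J (b, T, T') + 2 * (\<bar>C1\<bar> * C0) * I T'"
        using large[OF s] by (simp add: distrib_left)
    qed
    \<comment> \<open>The weight \<tau> occurs in the stabilization but not in the sum of jumps,
      hence the division by it.\<close>
    also have "\<dots> = 2 / \<tau> * (stab_norm k \<tau> \<alpha> h \<S> v)\<^sup>2 + 2 * (\<bar>C1\<bar> * C0) * (\<Sum>(b, T, T')\<in>\<S>. I T')"
      using assms(6) unfolding stab[symmetric]
      by (simp add: sum.distrib sum_distrib_left split_beta mult.assoc)
    also have "(\<Sum>(b, T, T')\<in>\<S>. I T') \<le> K * (\<Sum>T\<in>?A. I T)"
      unfolding K_def using triple near A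
      by (intro sum_stab_triples_le[OF mesh assms(3) h(1) \<open>R > 0\<close> finS M, where c = c] I_nonneg) auto
    also have "(\<Sum>T\<in>?A. I T) = (l2_grad_norm m \<Omega> v)\<^sup>2"
      unfolding I_def l2_grad_norm_power2
      by (rule active_fe_space_sum_integral[OF mesh v \<open>closed \<Omega>\<close> \<Omega>(2) assms(3) h(1)])
    also have "2 / \<tau> * (stab_norm k \<tau> \<alpha> h \<S> v)\<^sup>2 + 2 * (\<bar>C1\<bar> * C0) * (K * (l2_grad_norm m \<Omega> v)\<^sup>2)
        \<le> (2 / \<tau> + D) * ((l2_grad_norm m \<Omega> v)\<^sup>2 + (stab_norm k \<tau> \<alpha> h \<S> v)\<^sup>2)"
    proof -
      \<comment> \<open>These are the two mixed terms by which the product on the right exceeds the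
        left side.\<close>
      have "0 \<le> 2 / \<tau> * (l2_grad_norm m \<Omega> v)\<^sup>2 + D * (stab_norm k \<tau> \<alpha> h \<S> v)\<^sup>2"
        using assms(6) \<open>D \<ge> 0\<close> by simp
      then show ?thesis by (simp add: D_def algebra_simps)
    qed
    finally show "(\<Sum>(b, T, T')\<in>\<S>. h powr \<alpha> * (form_norm b (?p T))\<^sup>2)
        \<le> (2 / \<tau> + D) * ((l2_grad_norm m \<Omega> v)\<^sup>2 + (stab_norm k \<tau> \<alpha> h \<S> v)\<^sup>2)"
      using \<open>C0 \<ge> 0\<close> by (simp add: mult_left_mono)
  qed
qed

end
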